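(* There is an absolute constant $C>0$ such that the following holds. Let $\{a_n\}_{n\ge 0}$ and $\{b_n\}_{n\ge1}$ be sequences with $a_n\to0$ and $b_n\to 0$ as $n\to\infty$, and suppose that the sequences $\{\Delta a_n\}_{n\ge1}$ and $\{\Delta b_n\}_{n\ge1}$ are in $a_{1,2}$. Then the cosine series $$\frac{a_0}{2}+\sum_{n=1}^\infty a_n\cos nx$$ represents an integrable function on $[0,\pi]$, and for $0<x\le\pi$ $$\sum_{n=1}^\infty b_n\sin nx=\frac1x\,B\!\left(\frac{\pi}{2x}\right)+\Gamma(x),$$ where $\int_0^\pi|\Gamma(x)|\,dx\le C\,\|\{\Delta b_n\}\|_{a_{1,2}}$.
   Context: For a sequence $\{d_n\}$, $\Delta d_n=d_n-d_{n+1}$. A sequence $\{d_n\}_{n\ge1}$ is in the space $a_{1,2}$ if $$\|\{d_n\}\|_{a_{1,2}}=\sum_{m=0}^\infty\left\{\sum_{j=1}^\infty\left[\sum_{n=j2^m}^{(j+1)2^m-1}|d_n|\right]^2\right\}^{1/2}<\infty.$$ The function $B:[0,\infty)\to\mathbb{C}$ is the piecewise linear interpolation of the sequence $\{b_n\}$, with $b_0=0$: for each integer $n\ge0$ and $x\in[n,n+1]$, $B(x)=b_n+(n-x)\Delta b_n$. A cosine series "represents an integrable function on $[0,\pi]$" if it is the Fourier (cosine) series of a function in $L^1(0,\pi)$. *)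

theory Defs
  imports "HOL-Analysis.Analysis"
begin

definition Delta :: "(nat \<Rightarrow> complex) \<Rightarrow> nat \<Rightarrow> complex" where
  "Delta d n = d n - d (n + 1)"

definition a12_block :: "(nat \<Rightarrow> complex) \<Rightarrow> nat \<Rightarrow> nat \<Rightarrow> real" where
  "a12_block d m j = (\<Sum>n = j * 2 ^ m..(j + 1) * 2 ^ m - 1. norm (d n))"

(* The outer index j of the blocks ranges over j >= 1, hence the shift by Suc below;
   the value d 0 is never used. *)

definition a12_term :: "(nat \<Rightarrow> complex) \<Rightarrow> nat \<Rightarrow> real" where
  "a12_term d m = sqrt (\<Sum>i. (a12_block d m (Suc i))\<^sup>2)"

(* "norm < \<infinity>" is convergence of the inner series for every m together with convergence
   of the outer one; the norm itself is then the real number a12_norm. *)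

definition in_a12 :: "(nat \<Rightarrow> complex) \<Rightarrow> bool" where
  "in_a12 d \<longleftrightarrow>
     (\<forall>m. summable (\<lambda>i. (a12_block d m (Suc i))\<^sup>2)) \<and> summable (a12_term d)"

definition a12_norm :: "(nat \<Rightarrow> complex) \<Rightarrow> real" where
  "a12_norm d = (\<Sum>m. a12_term d m)"

definition interp :: "(nat \<Rightarrow> complex) \<Rightarrow> real \<Rightarrow> complex" where
  "interp b x = (let n = nat \<lfloor>x\<rfloor> in b n + of_real (real n - x) * Delta b n)"

lemma interp_eq:
  assumes "x \<in> {real n..real n + 1}"
  shows "interp b x = b n + of_real (real n - x) * Delta b n"
proof (cases "x = real n + 1")
  case True
  then have "nat \<lfloor>x\<rfloor> = n + 1" by linarith
  with True show ?thesis by (simp add: interp_def Delta_def)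
next
  case False
  with assms have "real n \<le> x" "x < real n + 1" by auto
  then have "nat \<lfloor>x\<rfloor> = n" by linarith
  then show ?thesis by (simp add: interp_def)
qed

(* a 0 / 2 + (\<Sum>n\<ge>1. a n * cos (n x)) is the Fourier cosine series of some f in L^1(0,pi). *)

definition is_L1_cosine_series :: "(nat \<Rightarrow> complex) \<Rightarrow> bool" where
  "is_L1_cosine_series a \<longleftrightarrow>
     (\<exists>f :: real \<Rightarrow> complex. set_integrable lebesgue {0..pi} f \<and>
        (\<forall>n. a n = of_real (2 / pi) *
               (LINT x:{0..pi}|lebesgue. f x * of_real (cos (real n * x)))))"

end

theory Submission
  imports Defs
begin

text \<open>
  Summation by parts writes both the cosine series and the remainder \<open>\<Gamma>\<close> as
  \<open>\<Sum>n. d n * K n x\<close> with \<open>d = Delta a\<close> or \<open>d = Delta b\<close>, where \<open>K n\<close> is the Dirichlet kernel,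
  respectively the conjugate Dirichlet kernel minus \<open>1/x\<close> times the interpolation of the
  indicator of \<open>{1..n}\<close> at \<open>pi/(2x)\<close>. Both kernels are \<open>O(n)\<close> everywhere, and as soon as
  \<open>n x \<ge> pi/2\<close> they have the form \<open>g x + h x e^(inx) + h' x e^(-inx)\<close> with \<open>g = O(1)\<close> and
  \<open>h, h' = O(1/x)\<close>.

  On the dyadic interval \<open>(pi/2^(k+1), pi/2^k]\<close> the terms with \<open>n < 2^k\<close> and the part \<open>g\<close> are
  controlled by the \<open>l^1\<close> norm of \<open>d\<close>. The rest is at most \<open>O(2^k)\<close> times the exponential sum
  \<open>S = \<Sum>n\<ge>2^k. d n e^(inx)\<close>. Put \<open>N = 2^k\<close>. Since \<open>P = \<Sum>j<N. e^(ijx)\<close> satisfies \<open>|P| \<ge> 2N/pi\<close> for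
  \<open>|x| \<le> pi/N\<close>, Parseval's identity for \<open>S P\<close> bounds the \<open>L^2\<close> norm of \<open>S\<close> there by the \<open>l^2\<close> norm
  of the sums of \<open>|d n|\<close> over blocks of length \<open>N\<close>, and the Cauchy-Schwarz inequality then gives
  \<open>O(2^k) * \<integral>|S| = O(a12_term d k)\<close>. Summing over \<open>k\<close> yields \<open>O(a12_norm d)\<close>. For the cosine
  series the same bound, applied to the tails of \<open>d\<close>, gives \<open>L^1\<close> convergence and hence the
  Fourier coefficients.
\<close>

subsection \<open>Local mean values of trigonometric polynomials\<close>

text \<open>Jordan's inequality: sine is concave on \<open>[0, pi/2]\<close>, so it lies above the
  chord joining the endpoints.\<close>

lemma sin_ge_linear:
  fixes t :: real
  assumes "0 \<le> t" "t \<le> pi / 2"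
  shows "2 / pi * t \<le> sin t"
proof -
  have "concave_on {0..pi/2} (sin :: real \<Rightarrow> real)"
    unfolding concave_on_def
  proof (rule f''_ge0_imp_convex[where f'="\<lambda>x. - cos x" and f''="\<lambda>x. sin x"])
    show "0 \<le> sin x" if "x \<in> {0..pi/2}" for x :: real
      using that by (intro sin_ge_zero) auto
  qed (auto intro!: derivative_eq_intros)
  then have "(1 - u) * sin 0 + u * sin (pi/2) \<le> sin ((1 - u) *\<^sub>R 0 + u *\<^sub>R (pi/2))"
    if "u \<in> {0..1}" for u :: real
    using that by (intro concave_onD) auto
  from this[of "2 / pi * t"] show ?thesis
    using assms by (simp add: field_simps)
qed

lemma norm_one_minus_cis: "norm (1 - cis t) = 2 * \<bar>sin (t / 2)\<bar>"
  using dist_exp_i_1[of t] by (simp add: cis_conv_exp norm_minus_commute)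

text \<open>The geometric sum has modulus \<open>|sin (N x / 2)| / |sin (x / 2)|\<close>. Jordan's
  inequality bounds the numerator below by \<open>N x / pi\<close>, and the denominator is at most
  \<open>x / 2\<close>.\<close>

lemma norm_sum_cis_ge:
  assumes "N \<ge> 1" "0 \<le> x" "x \<le> pi / real N"
  shows "2 * real N / pi \<le> norm (\<Sum>k<N. cis (real k * x))"
proof (cases "x = 0")
  case True
  then show ?thesis using mult_right_mono[OF pi_ge_two, of "real N"] by (simp add: field_simps)
next
  case False
  then have x: "x > 0" using assms by simp
  have Nx: "real N * x \<le> pi" using assms by (simp add: field_simps)
  have "(1 - cis x) * (\<Sum>k<N. cis (real k * x)) = 1 - cis (real N * x)"
    unfolding Complex.DeMoivre[symmetric] by (rule one_diff_power_eq[symmetric])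
  then have "norm (1 - cis x) * norm (\<Sum>k<N. cis (real k * x)) = norm (1 - cis (real N * x))"
    by (metis norm_mult)
  then have eq: "\<bar>sin (x/2)\<bar> * norm (\<Sum>k<N. cis (real k * x)) = \<bar>sin (real N * x / 2)\<bar>"
    by (simp add: norm_one_minus_cis)
  have "2 / pi * (real N * x / 2) \<le> sin (real N * x / 2)"
    using x Nx by (intro sin_ge_linear) auto
  also have "\<dots> \<le> \<bar>sin (x/2)\<bar> * norm (\<Sum>k<N. cis (real k * x))" using eq by simp
  also have "\<dots> \<le> (x/2) * norm (\<Sum>k<N. cis (real k * x))"
    using x by (intro mult_right_mono) (metis abs_of_pos abs_sin_x_le_abs_x half_gt_zero, simp)
  finally show ?thesis using x by (simp add: field_simps)
qed

section \<open>Orthogonality and mean squares over a full period\<close>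

lemma has_integral_cis:
  fixes m n :: nat
  shows "((\<lambda>x. cis (real m * x) * cnj (cis (real n * x))) has_integral
           (if m = n then of_real (2 * pi) else 0)) {-pi..pi}"
proof (cases "m = n")
  case True
  then show ?thesis
    using has_integral_const_real[of "1::complex" "-pi" pi]
    by (simp add: complex_norm_square[symmetric] scaleR_conv_of_real)
next
  case False
  define w where "w = real m - real n"
  have w: "w \<noteq> 0" using False by (simp add: w_def)
  have eq: "cis (real m * x) * cnj (cis (real n * x)) = cis (w * x)" for x
    by (simp add: cis_cnj cis_mult w_def algebra_simps)
  have "((\<lambda>x. cis (w * x)) has_integral (cis (w * pi) / (\<i> * w) - cis (w * (-pi)) / (\<i> * w))) {-pi..pi}"
  proof (rule fundamental_theorem_of_calculus)
    show "((\<lambda>x. cis (w * x) / (\<i> * w)) has_vector_derivative cis (w * x)) (at x within {-pi..pi})" for x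
    proof -
      have "((\<lambda>z. exp (\<i> * (w * z)) / (\<i> * w)) has_field_derivative exp (\<i> * (w * x))) (at (of_real x))"
        using w by (auto intro!: derivative_eq_intros simp: field_simps)
      from has_vector_derivative_real_field[OF this] show ?thesis
        by (simp add: cis_conv_exp)
    qed
  qed auto
  moreover have "cis (w * pi) = cis (w * (-pi))"
  proof -
    have "w * pi = of_int (int m - int n) * pi" by (simp add: w_def)
    then have "sin (w * pi) = 0" by (metis Ints_of_int sin_times_pi_eq_0)
    then show ?thesis by (simp add: complex_eq_iff)
  qed
  ultimately show ?thesis using False by (simp add: eq)
qed

text \<open>The frequencies \<open>e i\<close> may repeat, so that a product of two trigonometric
  sums can be expanded over pairs of indices without collecting equal frequencies.\<close>

lemma has_integral_norm_trig_sum_squared: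
  fixes c :: "'i \<Rightarrow> complex" and e :: "'i \<Rightarrow> nat"
  assumes "finite I"
  shows "((\<lambda>x. of_real ((norm (\<Sum>i\<in>I. c i * cis (real (e i) * x)))\<^sup>2)) has_integral
           (\<Sum>i\<in>I. \<Sum>j\<in>I. c i * cnj (c j) * (if e i = e j then of_real (2 * pi) else 0))) {-pi..pi}"
proof -
  have eq: "of_real ((norm (\<Sum>i\<in>I. c i * cis (real (e i) * x)))\<^sup>2) =
      (\<Sum>i\<in>I. \<Sum>j\<in>I. c i * cnj (c j) * (cis (real (e i) * x) * cnj (cis (real (e j) * x))))" for x
    by (simp add: complex_norm_square sum_product mult_ac del: of_real_power)
  show ?thesis unfolding eq
    by (intro has_integral_sum assms has_integral_mult_right has_integral_cis)
qed

lemma integral_norm_trig_sum_squared_le: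
  fixes c :: "'i \<Rightarrow> complex" and e :: "'i \<Rightarrow> nat"
  assumes "finite I"
  shows "integral {-pi..pi} (\<lambda>x. (norm (\<Sum>i\<in>I. c i * cis (real (e i) * x)))\<^sup>2) \<le>
           2 * pi * (\<Sum>i\<in>I. \<Sum>j\<in>I. norm (c i) * norm (c j) * (if e i = e j then 1 else 0))"
proof -
  let ?R = "\<Sum>i\<in>I. \<Sum>j\<in>I. c i * cnj (c j) * (if e i = e j then of_real (2 * pi) else 0)"
  have "integral {-pi..pi} (\<lambda>x. (norm (\<Sum>i\<in>I. c i * cis (real (e i) * x)))\<^sup>2) = Re ?R"
    using has_integral_Re[OF has_integral_norm_trig_sum_squared[OF assms, of c e]]
    by (intro integral_unique) simp
  also have "\<dots> \<le> norm ?R" by (rule complex_Re_le_cmod)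
  also have "\<dots> \<le> (\<Sum>i\<in>I. \<Sum>j\<in>I. norm (c i * cnj (c j) * (if e i = e j then of_real (2 * pi) else 0)))"
    by (intro sum_norm_le norm_sum)
  also have "\<dots> = 2 * pi * (\<Sum>i\<in>I. \<Sum>j\<in>I. norm (c i) * norm (c j) * (if e i = e j then 1 else 0))"
    by (simp add: sum_distrib_left norm_mult if_distrib cong: if_cong) (simp add: mult_ac cong: if_cong)
  finally show ?thesis .
qed

text \<open>Each product is at most the mean of the two squares. The band is symmetric, and every
  index has at most three neighbours in it, itself included.\<close>

lemma sum_neighbours_le:
  fixes B :: "nat \<Rightarrow> real"
  shows "(\<Sum>i<J. \<Sum>j<J. B i * B j * (if i \<le> j + 1 \<and> j \<le> i + 1 then 1 else 0)) \<le> 3 * (\<Sum>j<J. (B j)\<^sup>2)"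
proof -
  let ?c = "\<lambda>i j::nat. if i \<le> j + 1 \<and> j \<le> i + 1 then 1 else (0::real)"
  have c: "(\<Sum>j<J. ?c i j) \<le> 3" for i
  proof -
    have "(\<Sum>j<J. ?c i j) = real (card {j\<in>{..<J}. i \<le> j + 1 \<and> j \<le> i + 1})"
      by (subst sum.inter_filter[symmetric]) auto
    also have "card {j\<in>{..<J}. i \<le> j + 1 \<and> j \<le> i + 1} \<le> card {i - 1..i + 1}"
      by (intro card_mono) auto
    also have "\<dots> \<le> 3" by simp
    finally show ?thesis by simp
  qed
  have half: "(t + t) / 2 = t" for t :: real by simp
  have "(\<Sum>i<J. \<Sum>j<J. B i * B j * ?c i j) \<le> (\<Sum>i<J. \<Sum>j<J. ((B i)\<^sup>2 * ?c i j + (B j)\<^sup>2 * ?c j i) / 2)"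
  proof (intro sum_mono)
    fix i j
    have "B i * B j \<le> ((B i)\<^sup>2 + (B j)\<^sup>2) / 2"
      using sum_squares_bound[of "B i" "B j"] by simp
    then show "B i * B j * ?c i j \<le> ((B i)\<^sup>2 * ?c i j + (B j)\<^sup>2 * ?c j i) / 2" by auto
  qed
  also have "\<dots> = ((\<Sum>i<J. \<Sum>j<J. (B i)\<^sup>2 * ?c i j) + (\<Sum>i<J. \<Sum>j<J. (B j)\<^sup>2 * ?c j i)) / 2"
    by (simp only: sum.distrib sum_divide_distrib[symmetric])
  also have "(\<Sum>i<J. \<Sum>j<J. (B j)\<^sup>2 * ?c j i) = (\<Sum>i<J. \<Sum>j<J. (B i)\<^sup>2 * ?c i j)"
    by (rule sum.swap)
  also have "((\<Sum>i<J. \<Sum>j<J. (B i)\<^sup>2 * ?c i j) + (\<Sum>i<J. \<Sum>j<J. (B i)\<^sup>2 * ?c i j)) / 2 = (\<Sum>i<J. (B i)\<^sup>2 * (\<Sum>j<J. ?c i j))"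
    by (simp only: sum_distrib_left half)
  also have "\<dots> \<le> (\<Sum>i<J. (B i)\<^sup>2 * 3)"
    by (intro sum_mono mult_left_mono c) auto
  finally show ?thesis by (simp add: sum_distrib_left mult.commute)
qed

text \<open>Two indices at distance less than \<open>N\<close> lie in the same or in adjacent blocks
  of length \<open>N\<close>, which reduces the sum to neighbouring block sums.\<close>

lemma sum_close_pairs_le:
  fixes u :: "nat \<Rightarrow> real"
  assumes N: "N \<ge> 1" and u: "\<And>n. u n \<ge> 0"
  shows "(\<Sum>n<J*N. \<Sum>m<J*N. u n * u m * (if n < m + N \<and> m < n + N then 1 else 0))
       \<le> 3 * (\<Sum>j<J. (\<Sum>n = j*N..<j*N+N. u n)\<^sup>2)"
proof -
  let ?c = "\<lambda>i j::nat. if i \<le> j + 1 \<and> j \<le> i + 1 then 1 else (0::real)"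
  define B where "B j = (\<Sum>n = j*N..<j*N+N. u n)" for j
  have dv: "n div N \<le> m div N + 1" if "n < m + N" for n m
    using that N div_le_mono[of n "m + N" N] by simp
  have "(\<Sum>n<J*N. \<Sum>m<J*N. u n * u m * (if n < m + N \<and> m < n + N then 1 else 0))
      \<le> (\<Sum>n<J*N. \<Sum>m<J*N. u n * u m * ?c (n div N) (m div N))"
    by (intro sum_mono mult_left_mono mult_nonneg_nonneg u) (auto dest: dv)
  also have "\<dots> = (\<Sum>i<J. \<Sum>n=i*N..<i*N+N. \<Sum>j<J. \<Sum>m=j*N..<j*N+N. u n * u m * ?c (n div N) (m div N))"
    by (simp only: sum.nat_group[symmetric])
  also have "\<dots> = (\<Sum>i<J. \<Sum>n=i*N..<i*N+N. \<Sum>j<J. \<Sum>m=j*N..<j*N+N. u n * u m * ?c i j)"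
  proof -
    have "n div N = i" if "n \<in> {i*N..<i*N+N}" for n i
      using that N by (intro div_nat_eqI) (auto simp: mult.commute)
    then show ?thesis by (intro sum.cong refl) simp
  qed
  also have "\<dots> = (\<Sum>i<J. \<Sum>j<J. B i * B j * ?c i j)"
  proof (rule sum.cong[OF refl])
    fix i assume "i \<in> {..<J}"
    have "(\<Sum>n=i*N..<i*N+N. \<Sum>j<J. \<Sum>m=j*N..<j*N+N. u n * u m * ?c i j)
        = (\<Sum>j<J. \<Sum>n=i*N..<i*N+N. \<Sum>m=j*N..<j*N+N. u n * u m * ?c i j)"
      by (rule sum.swap)
    also have "\<dots> = (\<Sum>j<J. B i * B j * ?c i j)"
      unfolding B_def sum_product unfolding sum_distrib_right by simp
    finally show "(\<Sum>n=i*N..<i*N+N. \<Sum>j<J. \<Sum>m=j*N..<j*N+N. u n * u m * ?c i j) = (\<Sum>j<J. B i * B j * ?c i j)" .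
  qed
  also have "\<dots> \<le> 3 * (\<Sum>j<J. (B j)\<^sup>2)" by (rule sum_neighbours_le)
  finally show ?thesis by (simp add: B_def)
qed

text \<open>In the expansion over pairs \<open>(n, k)\<close> only those with
  \<open>n + k = m + l\<close> interact. For given \<open>n\<close> and \<open>m\<close> this has at
  most \<open>N\<close> solutions with \<open>k, l < N\<close>, and none unless \<open>n\<close> and
  \<open>m\<close> differ by less than \<open>N\<close>. The constant is \<open>2 * pi\<close> from
  Parseval, \<open>N\<close> from this count and 3 from neighbouring blocks.\<close>

lemma integral_trig_sum_mult_kernel_le:
  fixes d :: "nat \<Rightarrow> complex"
  assumes N: "N \<ge> 1"
  shows "integral {-pi..pi} (\<lambda>x. (norm ((\<Sum>n<J*N. d n * cis (real n * x)) * (\<Sum>k<N. cis (real k * x))))\<^sup>2)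
    \<le> 6 * pi * real N * (\<Sum>j<J. (\<Sum>n = j*N..<j*N+N. norm (d n))\<^sup>2)"
proof -
  let ?I = "{..<J*N} \<times> {..<N}"
  have eq: "(\<Sum>n<J*N. d n * cis (real n * x)) * (\<Sum>k<N. cis (real k * x))
      = (\<Sum>p\<in>?I. d (fst p) * cis (real (fst p + snd p) * x))" for x
    unfolding sum_product sum.cartesian_product
    by (intro sum.cong refl) (auto simp: cis_mult algebra_simps)
  have cnt: "(\<Sum>k<N. \<Sum>l<N. if n + k = m + l then 1 else (0::real))
      \<le> real N * (if n < m + N \<and> m < n + N then 1 else 0)" for n m :: nat
  proof (cases "n < m + N \<and> m < n + N")
    case True
    have "(\<Sum>l<N. if n + k = m + l then 1 else (0::real)) \<le> 1" for k
    proof -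
      have "(\<Sum>l<N. if n + k = m + l then 1 else (0::real)) = real (card {l\<in>{..<N}. n + k = m + l})"
        by (subst sum.inter_filter[symmetric]) auto
      also have "card {l\<in>{..<N}. n + k = m + l} \<le> card {n + k - m}"
        by (intro card_mono) auto
      finally show ?thesis by simp
    qed
    then have "(\<Sum>k<N. \<Sum>l<N. if n + k = m + l then 1 else (0::real)) \<le> (\<Sum>k<N. 1)"
      by (intro sum_mono)
    with True show ?thesis by simp
  next
    case False
    then have "(\<Sum>k<N. \<Sum>l<N. if n + k = m + l then 1 else (0::real)) = 0"
      by (intro sum.neutral ballI) auto
    with False show ?thesis by simp
  qed
  have "(\<Sum>p\<in>?I. \<Sum>q\<in>?I. norm (d (fst p)) * norm (d (fst q)) * (if fst p + snd p = fst q + snd q then 1 else 0))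
     = (\<Sum>n<J*N. \<Sum>k<N. \<Sum>m<J*N. \<Sum>l<N. norm (d n) * norm (d m) * (if n + k = m + l then 1 else 0))"
    by (simp add: sum.cartesian_product' del: mult_eq_if)
  also have "\<dots> = (\<Sum>n<J*N. \<Sum>m<J*N. \<Sum>k<N. \<Sum>l<N. norm (d n) * norm (d m) * (if n + k = m + l then 1 else 0))"
    by (intro sum.cong[OF refl] sum.swap)
  also have "\<dots> = (\<Sum>n<J*N. \<Sum>m<J*N. norm (d n) * norm (d m) * (\<Sum>k<N. \<Sum>l<N. if n + k = m + l then 1 else 0))"
    by (simp only: sum_distrib_left)
  also have "\<dots> \<le> (\<Sum>n<J*N. \<Sum>m<J*N. norm (d n) * norm (d m) * (real N * (if n < m + N \<and> m < n + N then 1 else 0)))"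
    by (intro sum_mono mult_left_mono cnt) auto
  also have "\<dots> = real N * (\<Sum>n<J*N. \<Sum>m<J*N. norm (d n) * norm (d m) * (if n < m + N \<and> m < n + N then 1 else 0))"
    by (simp only: sum_distrib_left mult_ac)
  also have "\<dots> \<le> real N * (3 * (\<Sum>j<J. (\<Sum>n = j*N..<j*N+N. norm (d n))\<^sup>2))"
    by (intro mult_left_mono sum_close_pairs_le N) auto
  finally have *: "(\<Sum>p\<in>?I. \<Sum>q\<in>?I. norm (d (fst p)) * norm (d (fst q)) * (if fst p + snd p = fst q + snd q then 1 else 0))
    \<le> real N * (3 * (\<Sum>j<J. (\<Sum>n = j*N..<j*N+N. norm (d n))\<^sup>2))" .
  have "integral {-pi..pi} (\<lambda>x. (norm (\<Sum>p\<in>?I. d (fst p) * cis (real (fst p + snd p) * x)))\<^sup>2)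
    \<le> 2 * pi * (\<Sum>p\<in>?I. \<Sum>q\<in>?I. norm (d (fst p)) * norm (d (fst q)) * (if fst p + snd p = fst q + snd q then 1 else 0))"
    by (intro integral_norm_trig_sum_squared_le) simp
  also have "\<dots> \<le> 2 * pi * (real N * (3 * (\<Sum>j<J. (\<Sum>n = j*N..<j*N+N. norm (d n))\<^sup>2)))"
    by (intro mult_left_mono *) simp
  finally show ?thesis unfolding eq by simp
qed

text \<open>The factor \<open>P\<close> is at least \<open>2 * N / pi\<close> on the short interval,
  so \<open>S\<close> is controlled there by \<open>S * P\<close>, whose mean square is known over
  the full period. The bound \<open>t\<close> is strictly positive because it occurs in the
  denominator of a weight.\<close>

lemma integral_norm_trig_sum_le:
  fixes d :: "nat \<Rightarrow> complex"
  assumes N: "N \<ge> 1" and t: "t > 0"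
    and T: "(\<Sum>j<J. (\<Sum>n = j*N..<j*N+N. norm (d n))\<^sup>2) \<le> t\<^sup>2"
  shows "integral {0..pi / real N} (\<lambda>x. norm (\<Sum>n<J*N. d n * cis (real n * x))) \<le> 5 / 4 * pi\<^sup>2 * t / real N"
proof -
  define S where "S x = (\<Sum>n<J*N. d n * cis (real n * x))" for x
  define P where "P x = (\<Sum>k<N. cis (real k * x))" for x
  \<comment> \<open>Chosen so that \<open>c * (2 * N / pi)^2 = 1 / (2 * pi * t)\<close>, the
    coefficient of the square in AM-GM.\<close>
  define c where "c = pi / (8 * t * (real N)\<^sup>2)"
  have N0: "real N > 0" using N by simp
  have c: "c > 0" using t N0 by (simp add: c_def)
  have contS: "continuous_on A S" and contP: "continuous_on A P" for A
    unfolding S_def P_def cis_conv_exp by (intro continuous_intros)+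
  have int: "(\<lambda>x. (norm (S x * P x))\<^sup>2) integrable_on {a..b}" for a b :: real
    by (intro integrable_continuous_interval continuous_intros contS contP)
  \<comment> \<open>AM-GM with the weight \<open>pi * t\<close> plays the role of Cauchy-Schwarz.\<close>
  have le: "norm (S x) \<le> pi * t / 2 + c * (norm (S x * P x))\<^sup>2" if "x \<in> {0..pi / real N}" for x
  proof -
    have P: "2 * real N / pi \<le> norm (P x)"
      unfolding P_def using that N by (intro norm_sum_cis_ge) auto
    have "(2 * real N / pi)\<^sup>2 \<le> (norm (P x))\<^sup>2"
      using P N0 by (intro power_mono) auto
    then have "c * ((norm (S x))\<^sup>2 * (2 * real N / pi)\<^sup>2) \<le> c * (norm (S x * P x))\<^sup>2"
      unfolding norm_mult power_mult_distrib using c by (intro mult_left_mono) auto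
    moreover have "c * ((norm (S x))\<^sup>2 * (2 * real N / pi)\<^sup>2) = (norm (S x))\<^sup>2 / (2 * pi * t)"
      using N0 t by (simp add: c_def field_simps power2_eq_square)
    moreover have "norm (S x) \<le> pi * t / 2 + (norm (S x))\<^sup>2 / (2 * pi * t)"
      using sum_squares_bound[of "norm (S x)" "pi * t"] t
      by (simp add: field_simps power2_eq_square)
    ultimately show ?thesis by linarith
  qed
  have "integral {0..pi / real N} (\<lambda>x. norm (S x)) \<le> integral {0..pi / real N} (\<lambda>x. pi * t / 2 + c * (norm (S x * P x))\<^sup>2)"
    using le by (intro integral_le integrable_continuous_interval continuous_intros contS contP) auto
  also have "\<dots> = pi * t / 2 * (pi / real N) + c * integral {0..pi / real N} (\<lambda>x. (norm (S x * P x))\<^sup>2)"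
    using has_integral_add[OF has_integral_const_real[of "pi * t / 2" 0 "pi / real N"]
        has_integral_mult_right[OF integrable_integral[OF int], of c]] N0
    by (intro integral_unique) (simp add: mult_ac)
  \<comment> \<open>Orthogonality is available only on a full period; the integrand is nonnegative,
    so the interval may be enlarged.\<close>
  also have "integral {0..pi / real N} (\<lambda>x. (norm (S x * P x))\<^sup>2) \<le> integral {-pi..pi} (\<lambda>x. (norm (S x * P x))\<^sup>2)"
    using N0 N by (intro integral_subset_le int) (auto simp: field_simps intro: order_trans[of _ 0])
  also have "\<dots> \<le> 6 * pi * real N * (\<Sum>j<J. (\<Sum>n = j*N..<j*N+N. norm (d n))\<^sup>2)"
    unfolding S_def P_def by (rule integral_trig_sum_mult_kernel_le[OF N])
  also have "\<dots> \<le> 6 * pi * real N * t\<^sup>2"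
    by (intro mult_left_mono T) auto
  finally have "integral {0..pi / real N} (\<lambda>x. norm (S x)) \<le> pi * t / 2 * (pi / real N) + c * (6 * pi * real N * t\<^sup>2)"
    using c by simp
  \<comment> \<open>The two summands are \<open>1/2\<close> and \<open>3/4\<close> of
    \<open>pi^2 * t / N\<close>.\<close>
  also have "\<dots> = 5 / 4 * pi\<^sup>2 * t / real N"
    using N0 t by (simp add: c_def field_simps power2_eq_square)
  finally show ?thesis unfolding S_def .
qed

subsection \<open>The space of the sequences and its exponential series\<close>

lemma a12_block_nonneg: "0 \<le> a12_block d m j"
  by (simp add: a12_block_def sum_nonneg)

lemma a12_term_nonneg: "in_a12 d \<Longrightarrow> 0 \<le> a12_term d m"
  by (simp add: a12_term_def in_a12_def suminf_nonneg)

lemma sum_a12_block_squared_le: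
  assumes "in_a12 d"
  shows "(\<Sum>i<J. (a12_block d m (Suc i))\<^sup>2) \<le> (a12_term d m)\<^sup>2"
proof -
  have s: "summable (\<lambda>i. (a12_block d m (Suc i))\<^sup>2)" using assms by (simp add: in_a12_def)
  then have "(\<Sum>i<J. (a12_block d m (Suc i))\<^sup>2) \<le> (\<Sum>i. (a12_block d m (Suc i))\<^sup>2)"
    by (intro sum_le_suminf) auto
  also have "\<dots> = (a12_term d m)\<^sup>2"
    using s by (simp add: a12_term_def suminf_nonneg)
  finally show ?thesis .
qed

lemma a12_block_one_le_term:
  assumes "in_a12 d"
  shows "a12_block d m 1 \<le> a12_term d m"
  using sum_a12_block_squared_le[OF assms, where J=1 and m=m] a12_term_nonneg[OF assms]
  by (simp add: power2_le_iff_abs_le)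

lemma sum_a12_term_le_norm: "in_a12 d \<Longrightarrow> (\<Sum>m<M. a12_term d m) \<le> a12_norm d"
  unfolding a12_norm_def by (intro sum_le_suminf) (auto simp: a12_term_nonneg in_a12_def)

lemma a12_norm_nonneg: "in_a12 d \<Longrightarrow> 0 \<le> a12_norm d"
  using sum_a12_term_le_norm[of d 0] by simp

lemma a12_block_one: "a12_block d m 1 = (\<Sum>n = 2^m..<2^Suc m. norm (d n))"
proof -
  have "{1 * p..(1 + 1) * p - 1} = {p..<2 * p}" if "p > 0" for p :: nat
    using that by auto
  from this[of "2^m"] show ?thesis by (simp add: a12_block_def)
qed

lemma sum_dyadic_blocks: "(\<Sum>m<M. a12_block d m 1) = (\<Sum>n = 1..<2^M. norm (d n))"
proof (induction M)
  case (Suc M)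
  then show ?case using sum.atLeastLessThan_concat[of 1 "2^M" "2^Suc M" "\<lambda>n. norm (d n)"]
    by (simp only: sum.lessThan_Suc a12_block_one) simp
qed simp

text \<open>The blocks with \<open>j = 1\<close> at levels \<open>m = 0, 1, ...\<close> tile the
  positive integers, and each is a single entry of the \<open>l^2\<close> sum at its level. Index 0
  lies in no block, hence the assumption \<open>d 0 = 0\<close>.\<close>

lemma sum_norm_le_a12_norm:
  assumes "in_a12 d" "d 0 = 0"
  shows "(\<Sum>n<M. norm (d n)) \<le> a12_norm d"
proof -
  have "(\<Sum>n<M. norm (d n)) \<le> (\<Sum>n<2^M. norm (d n))"
    using less_exp[of M] by (intro sum_mono2) auto
  also have "\<dots> = (\<Sum>m<M. a12_block d m 1)"
    using assms(2) unfolding sum_dyadic_blocks by (simp add: lessThan_atLeast0 sum.atLeast_Suc_lessThan)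
  also have "\<dots> \<le> (\<Sum>m<M. a12_term d m)"
    by (intro sum_mono a12_block_one_le_term assms)
  also have "\<dots> \<le> a12_norm d" by (rule sum_a12_term_le_norm[OF assms(1)])
  finally show ?thesis .
qed

lemma summable_norm_a12:
  assumes "in_a12 d" "d 0 = 0"
  shows "summable (\<lambda>n. norm (d n))"
  using sum_norm_le_a12_norm[OF assms] by (intro summableI_nonneg_bounded) auto

lemma suminf_norm_le_a12_norm:
  assumes "in_a12 d" "d 0 = 0"
  shows "(\<Sum>n. norm (d n)) \<le> a12_norm d"
  using sum_norm_le_a12_norm[OF assms] by (intro suminf_le_const summable_norm_a12 assms) auto

text \<open>Initial terms are replaced by zero instead of being dropped, so that frequencies and
  blocks keep their indices.\<close>

definition tail_from :: "nat \<Rightarrow> (nat \<Rightarrow> complex) \<Rightarrow> nat \<Rightarrow> complex" where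
  "tail_from M d n = (if n < M then 0 else d n)"

lemma summable_norm_mult_bounded:
  fixes d v :: "nat \<Rightarrow> complex"
  assumes "summable (\<lambda>n. norm (d n))" "\<And>n. norm (v n) \<le> M"
  shows "summable (\<lambda>n. norm (d n * v n))"
  by (rule summable_comparison_test'[OF summable_mult2[OF assms(1), of M], of 0])
     (auto simp: norm_mult intro!: mult_left_mono assms(2))

text \<open>With \<open>N = 2^k\<close> the blocks of the polynomial estimate are the blocks of
  level \<open>k\<close>; Fatou's lemma carries the estimate from partial sums to the
  series.\<close>

lemma nn_integral_tail_le:
  assumes d: "in_a12 d" "d 0 = 0"
  shows "(\<integral>\<^sup>+x\<in>{0..pi / 2^k}. ennreal (norm (\<Sum>n. tail_from (2^k) d n * cis (real n * x))) \<partial>lborel)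
     \<le> ennreal (5 / 4 * pi\<^sup>2 * a12_term d k / 2^k)"
proof -
  define N :: nat where "N = 2^k"
  have N: "N \<ge> 1" "real N = 2^k" by (simp_all add: N_def)
  define d' where "d' = tail_from N d"
  define B where "B j = (\<Sum>n = j*N..<j*N+N. norm (d' n))" for j
  \<comment> \<open>The level-\<open>k\<close> sum starts at \<open>j = 1\<close>; cutting the
    series at \<open>N\<close> removes exactly the block \<open>j = 0\<close>.\<close>
  have B0: "B 0 = 0" by (simp add: B_def d'_def tail_from_def)
  have BS: "B (Suc i) = a12_block d k (Suc i)" for i
    unfolding B_def a12_block_def d'_def tail_from_def
    using N(1) by (intro sum.cong) (auto simp: N_def[symmetric])
  have T: "(\<Sum>j<J. (B j)\<^sup>2) \<le> (a12_term d k)\<^sup>2" for J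
  proof -
    have "(\<Sum>j<J. (B j)\<^sup>2) \<le> (\<Sum>j<Suc J. (B j)\<^sup>2)" by simp
    also have "\<dots> = (\<Sum>i<J. (a12_block d k (Suc i))\<^sup>2)"
      by (simp only: sum.lessThan_Suc_shift B0 BS) simp
    also have "\<dots> \<le> (a12_term d k)\<^sup>2" by (rule sum_a12_block_squared_le[OF d(1)])
    finally show ?thesis .
  qed
  define f where "f J x = norm (\<Sum>n<J*N. d' n * cis (real n * x))" for J x
  have f_meas [measurable]: "f J \<in> borel_measurable borel" for J
    unfolding f_def cis_conv_exp by measurable
  have fle: "(\<integral>\<^sup>+x\<in>{0..pi / real N}. ennreal (f J x) \<partial>lborel) \<le> ennreal (5 / 4 * pi\<^sup>2 * a12_term d k / real N)" for J
  proof -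
    have cont: "continuous_on A (f J)" for A
      unfolding f_def cis_conv_exp by (intro continuous_intros)
    have eq: "(\<integral>\<^sup>+x\<in>{0..pi / real N}. ennreal (f J x) \<partial>lborel) = ennreal (integral {0..pi / real N} (f J))"
      by (intro nn_integral_has_integral_lebesgue' integrable_integral integrable_continuous_interval cont)
         (simp add: f_def)
    \<comment> \<open>The polynomial estimate needs a positive bound, while
      \<open>a12_term d k\<close> may be zero, so it is applied to every larger \<open>t\<close> and
      \<open>t\<close> is then lowered.\<close>
    have "integral {0..pi / real N} (f J) \<le> 5 / 4 * pi\<^sup>2 * t / real N" if "t > a12_term d k" for t
    proof -
      have t: "t > 0" using that a12_term_nonneg[OF d(1), of k] by linarith
      have "(\<Sum>j<J. (\<Sum>n = j*N..<j*N+N. norm (d' n))\<^sup>2) \<le> t\<^sup>2"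
        using T[of J] power_mono[of "a12_term d k" t 2] that a12_term_nonneg[OF d(1), of k]
        unfolding B_def by linarith
      from integral_norm_trig_sum_le[OF N(1) t this] show ?thesis by (simp add: f_def[abs_def])
    qed
    then have "integral {0..pi / real N} (f J) * real N / (5 / 4 * pi\<^sup>2) \<le> t" if "t > a12_term d k" for t
      using that N by (simp add: field_simps)
    then have "integral {0..pi / real N} (f J) * real N / (5 / 4 * pi\<^sup>2) \<le> a12_term d k"
      by (rule dense_ge)
    then have "integral {0..pi / real N} (f J) \<le> 5 / 4 * pi\<^sup>2 * a12_term d k / real N"
      using N by (simp add: field_simps)
    then show ?thesis unfolding eq by (rule ennreal_leI)
  qed
  have sum': "summable (\<lambda>n. d' n * cis (real n * x))" for x
  proof (rule summable_norm_cancel, rule summable_norm_mult_bounded[where M=1])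
    show "summable (\<lambda>n. norm (d' n))"
      using summable_norm_a12[OF d]
      by (rule summable_comparison_test'[where N=0]) (simp add: d'_def tail_from_def)
  qed simp
  have lim: "(\<lambda>J. ennreal (f J x) * indicator {0..pi / real N} x) \<longlonglongrightarrow>
      ennreal (norm (\<Sum>n. d' n * cis (real n * x))) * indicator {0..pi / real N} x" for x
  proof -
    \<comment> \<open>Partial sums ending at multiples of \<open>N\<close> form a subsequence and
      have the same limit.\<close>
    have "strict_mono (\<lambda>J. J * N)" using N by (simp add: strict_mono_def)
    from LIMSEQ_subseq_LIMSEQ[OF summable_LIMSEQ[OF sum'[of x]] this]
    have "(\<lambda>J. f J x) \<longlonglongrightarrow> norm (\<Sum>n. d' n * cis (real n * x))"
      unfolding f_def by (intro tendsto_norm) (simp add: o_def)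
    then show ?thesis
      by (cases "x \<in> {0..pi / real N}") (auto intro!: tendsto_ennrealI)
  qed
  have "(\<integral>\<^sup>+x\<in>{0..pi / real N}. ennreal (norm (\<Sum>n. d' n * cis (real n * x))) \<partial>lborel)
      = (\<integral>\<^sup>+x. liminf (\<lambda>J. ennreal (f J x) * indicator {0..pi / real N} x) \<partial>lborel)"
    by (intro nn_integral_cong lim_imp_Liminf[symmetric] lim) simp
  also have "\<dots> \<le> liminf (\<lambda>J. \<integral>\<^sup>+x\<in>{0..pi / real N}. ennreal (f J x) \<partial>lborel)"
    by (intro nn_integral_liminf) measurable
  also have "\<dots> \<le> ennreal (5 / 4 * pi\<^sup>2 * a12_term d k / real N)"
    by (intro Liminf_le always_eventually allI fle) simp
  finally show ?thesis by (simp add: d'_def N_def)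
qed

text \<open>From level \<open>k\<close> to \<open>k + 1\<close> the weighted average is halved and
  gains at most the \<open>l^1\<close> norm of one dyadic block, so the total is at most twice the
  sum of these norms.\<close>

lemma sum_weighted_dyadic_le:
  assumes "in_a12 d"
  shows "(\<Sum>k<M. (\<Sum>n<2^k. real n * norm (d n)) / 2^k) \<le> 2 * a12_norm d"
proof -
  define W where "W k = (\<Sum>n<2^k. real n * norm (d n)) / 2^k" for k :: nat
  have W0: "W k \<ge> 0" for k by (simp add: W_def sum_nonneg)
  have step: "2 * W (Suc k) \<le> W k + 2 * a12_block d k 1" for k
  proof -
    have "(\<Sum>n<2^Suc k. real n * norm (d n)) = (\<Sum>n<2^k. real n * norm (d n)) + (\<Sum>n=2^k..<2^Suc k. real n * norm (d n))"
      using sum.atLeastLessThan_concat[of 0 "2^k" "2^Suc k" "\<lambda>n. real n * norm (d n)"]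
      by (simp add: lessThan_atLeast0)
    also have "(\<Sum>n=2^k..<2^Suc k. real n * norm (d n)) \<le> (\<Sum>n=2^k..<2^Suc k. 2^Suc k * norm (d n))"
    proof (intro sum_mono mult_right_mono)
      fix n :: nat assume "n \<in> {2^k..<2^Suc k}"
      then have "n \<le> 2^Suc k" by simp
      then have "real n \<le> real (2^Suc k)" by (rule of_nat_mono)
      then show "real n \<le> 2^Suc k" by simp
    qed simp
    also have "\<dots> = 2^Suc k * a12_block d k 1" by (simp only: a12_block_one sum_distrib_left)
    finally show ?thesis by (simp add: W_def field_simps)
  qed
  \<comment> \<open>The extra summand makes the recursion \<open>step\<close> telescope.\<close>
  have "(\<Sum>k<M. W k) + 2 * W M \<le> 2 * (\<Sum>k<M. a12_block d k 1)"
  proof (induction M)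
    case 0 then show ?case by (simp add: W_def)
  next
    case (Suc M) then show ?case using step[of M] by (simp add: algebra_simps)
  qed
  then have "(\<Sum>k<M. W k) \<le> 2 * (\<Sum>k<M. a12_block d k 1)" using W0[of M] by linarith
  also have "\<dots> \<le> 2 * (\<Sum>k<M. a12_term d k)"
    by (intro mult_left_mono sum_mono a12_block_one_le_term assms) simp
  also have "\<dots> \<le> 2 * a12_norm d" using sum_a12_term_le_norm[OF assms] by simp
  finally show ?thesis by (simp add: W_def)
qed

subsection \<open>Series of kernels\<close>

text \<open>Blocks with \<open>j > 0\<close> see only moduli at positive indices. This allows a
  sequence to be conjugated and its entry at 0 to be changed.\<close>

lemma a12_block_cong:
  assumes "\<And>n. n > 0 \<Longrightarrow> norm (d n) = norm (d' n)" "j > 0"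
  shows "a12_block d m j = a12_block d' m j"
proof -
  have "n > 0" if "n \<ge> j * 2^m" for n
    using that assms(2) by (metis gr0I le_zero_eq mult_is_0 power_not_zero zero_neq_numeral)
  then show ?thesis unfolding a12_block_def by (intro sum.cong refl assms(1)) auto
qed

lemma a12_term_cong:
  assumes "\<And>n. n > 0 \<Longrightarrow> norm (d n) = norm (d' n)"
  shows "a12_term d = a12_term d'"
proof
  fix m
  have "a12_block d m (Suc i) = a12_block d' m (Suc i)" for i
    using assms by (intro a12_block_cong) auto
  then show "a12_term d m = a12_term d' m" by (simp add: a12_term_def)
qed

lemma a12_norm_cong:
  assumes "\<And>n. n > 0 \<Longrightarrow> norm (d n) = norm (d' n)"
  shows "a12_norm d = a12_norm d'"
  using a12_term_cong[of d d', OF assms] by (simp add: a12_norm_def)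

lemma in_a12_cong:
  assumes "\<And>n. n > 0 \<Longrightarrow> norm (d n) = norm (d' n)"
  shows "in_a12 d = in_a12 d'"
proof -
  have "a12_block d m (Suc i) = a12_block d' m (Suc i)" for m i
    using assms by (intro a12_block_cong) auto
  moreover have "a12_term d = a12_term d'" using assms by (rule a12_term_cong)
  ultimately show ?thesis by (simp add: in_a12_def)
qed

lemma dyadic_interval_ex:
  fixes x :: real
  assumes "0 < x" "x \<le> pi"
  obtains k where "pi / 2^Suc k < x" "x \<le> pi / 2^k"
proof -
  have ex: "\<exists>k. pi / 2^k < x"
  proof -
    obtain k where "(1/2::real)^k < x / pi"
      using real_arch_pow_inv[of "x / pi" "1/2"] assms by auto
    then show ?thesis by (intro exI[of _ k]) (simp add: field_simps power_one_over)
  qed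
  define k where "k = (LEAST k. pi / 2^k < x)"
  have k: "pi / 2^k < x" unfolding k_def by (rule LeastI_ex[OF ex])
  then have "k \<noteq> 0" using assms by (auto intro!: gr0I)
  then obtain l where l: "k = Suc l" by (cases k) auto
  have "\<not> pi / 2^l < x" using not_less_Least[of l "\<lambda>k. pi / 2^k < x"] l by (simp add: k_def)
  then show ?thesis using k l by (intro that[of l]) auto
qed

text \<open>Absolute summability of \<open>d\<close> suffices, since the factors are bounded:
  finitely many arbitrary values, then an explicit bounded form.\<close>

lemma summable_kernel_series:
  fixes d :: "nat \<Rightarrow> complex" and v :: "nat \<Rightarrow> complex"
  assumes d: "in_a12 d" "d 0 = 0"
    and v: "\<And>n. n \<ge> M \<Longrightarrow> v n = g + h * cis (real n * x) + h' * cis (- (real n * x))"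
  shows "summable (\<lambda>n. norm (d n * v n))"
proof (rule summable_norm_mult_bounded[OF summable_norm_a12[OF d]])
  \<comment> \<open>Using \<open>Suc M\<close> keeps the set nonempty for \<open>M = 0\<close>;
    since it contains the modulus of \<open>v 0\<close>, the maximum is nonnegative.\<close>
  let ?m = "Max ((\<lambda>n. norm (v n)) ` {..<Suc M})"
  show "norm (v n) \<le> ?m + (norm g + norm h + norm h')" for n
  proof (cases "n < M")
    case True
    then have "norm (v n) \<le> ?m" by (intro Max_ge) auto
    then show ?thesis by (simp add: add_increasing2)
  next
    case False
    have "norm (v n) \<le> norm g + norm h + norm h'"
      using False v[of n] norm_triangle_ineq[of "g + h * cis (real n * x)" "h' * cis (- (real n * x))"]
        norm_triangle_ineq[of g "h * cis (real n * x)"] by (simp add: norm_mult)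
    moreover have "0 \<le> ?m"
      by (rule order_trans[OF norm_ge_zero[of "v 0"]], rule Max_ge) auto
    ultimately show ?thesis by linarith
  qed
qed

text \<open>The series is cut at \<open>M\<close>. The head uses the linear bound; the tail
  separates into a constant part, controlled by the \<open>l^1\<close> norm, and two exponential
  series.\<close>

lemma norm_kernel_series_le:
  fixes d :: "nat \<Rightarrow> complex" and v :: "nat \<Rightarrow> complex"
  assumes d: "in_a12 d" "d 0 = 0" and A: "A \<ge> 0"
    and v1: "\<And>n. n < M \<Longrightarrow> n \<ge> 1 \<Longrightarrow> norm (v n) \<le> A * real n"
    and v2: "\<And>n. n \<ge> M \<Longrightarrow> v n = g + h * cis (real n * x) + h' * cis (- (real n * x))"
    and g: "norm g \<le> A" and h: "norm h \<le> H" and h': "norm h' \<le> H"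
  shows "norm (\<Sum>n. d n * v n) \<le> A * (\<Sum>n<M. real n * norm (d n)) + A * a12_norm d
      + H * (norm (\<Sum>n. tail_from M d n * cis (real n * x)) + norm (\<Sum>n. tail_from M (\<lambda>n. cnj (d n)) n * cis (real n * x)))"
proof -
  let ?t = "tail_from M d"
  have sd: "summable (\<lambda>n. norm (d n))" by (rule summable_norm_a12[OF d])
  have st: "summable (\<lambda>n. norm (?t n))"
    by (rule summable_comparison_test'[OF sd, of 0]) (simp add: tail_from_def)
  have s1: "summable (\<lambda>n. ?t n * cis (real n * x))" "summable (\<lambda>n. ?t n * cis (- (real n * x)))"
    by (rule summable_norm_cancel, rule summable_norm_mult_bounded[OF st, where M=1], simp)+
  have s0: "summable ?t" by (rule summable_norm_cancel[OF st])
  have hd: "(\<lambda>n. if n \<in> {..<M} then d n * v n else 0) sums (\<Sum>n<M. d n * v n)"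
    by (rule sums_If_finite_set) simp
  have tl: "(\<lambda>n. ?t n * g + h * (?t n * cis (real n * x)) + h' * (?t n * cis (- (real n * x))))
      sums (suminf ?t * g + h * (\<Sum>n. ?t n * cis (real n * x)) + h' * (\<Sum>n. ?t n * cis (- (real n * x))))"
    by (intro sums_add sums_mult sums_mult2 summable_sums s1 s0)
  have split: "d n * v n = (if n \<in> {..<M} then d n * v n else 0)
       + (?t n * g + h * (?t n * cis (real n * x)) + h' * (?t n * cis (- (real n * x))))" for n
    using v2[of n] by (simp add: tail_from_def algebra_simps)
  have sums: "(\<lambda>n. d n * v n) sums ((\<Sum>n<M. d n * v n)
      + (suminf ?t * g + h * (\<Sum>n. ?t n * cis (real n * x)) + h' * (\<Sum>n. ?t n * cis (- (real n * x)))))"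
    by (subst split, rule sums_add[OF hd tl])
  \<comment> \<open>Conjugation turns the series with negative frequencies into one with positive
    frequencies, to which the mean value estimate applies.\<close>
  have cnj: "norm (\<Sum>n. ?t n * cis (- (real n * x))) = norm (\<Sum>n. tail_from M (\<lambda>n. cnj (d n)) n * cis (real n * x))"
  proof -
    have "(\<lambda>n. cnj (?t n * cis (- (real n * x)))) sums cnj (\<Sum>n. ?t n * cis (- (real n * x)))"
      using s1(2) by (subst sums_cnj) (rule summable_sums)
    moreover have "cnj (?t n * cis (- (real n * x))) = tail_from M (\<lambda>n. cnj (d n)) n * cis (real n * x)" for n
      by (simp add: tail_from_def cis_cnj)
    ultimately have "(\<Sum>n. tail_from M (\<lambda>n. cnj (d n)) n * cis (real n * x)) = cnj (\<Sum>n. ?t n * cis (- (real n * x)))"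
      by (simp add: sums_iff)
    then show ?thesis by simp
  qed
  have "norm (\<Sum>n<M. d n * v n) \<le> (\<Sum>n<M. A * (real n * norm (d n)))"
  proof (rule sum_norm_le)
    fix n assume "n \<in> {..<M}"
    then show "norm (d n * v n) \<le> A * (real n * norm (d n))"
      using d(2) v1[of n] mult_left_mono[of "norm (v n)" "A * real n" "norm (d n)"]
      by (cases "n = 0") (auto simp: norm_mult mult_ac)
  qed
  then have n1: "norm (\<Sum>n<M. d n * v n) \<le> A * (\<Sum>n<M. real n * norm (d n))"
    by (simp add: sum_distrib_left)
  have "norm (suminf ?t) \<le> (\<Sum>n. norm (?t n))" by (rule summable_norm[OF st])
  also have "\<dots> \<le> (\<Sum>n. norm (d n))" by (rule suminf_le[OF _ st sd]) (simp add: tail_from_def)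
  also have "\<dots> \<le> a12_norm d" by (rule suminf_norm_le_a12_norm[OF d])
  finally have n2: "norm (suminf ?t * g) \<le> A * a12_norm d"
    using g A unfolding norm_mult by (subst mult.commute) (intro mult_mono, auto)
  have n3: "norm (h * (\<Sum>n. ?t n * cis (real n * x))) \<le> H * norm (\<Sum>n. ?t n * cis (real n * x))"
    unfolding norm_mult by (intro mult_right_mono h) auto
  have n4: "norm (h' * (\<Sum>n. ?t n * cis (- (real n * x)))) \<le> H * norm (\<Sum>n. ?t n * cis (- (real n * x)))"
    unfolding norm_mult by (intro mult_right_mono h') auto
  have "norm (\<Sum>n. d n * v n) \<le> norm (\<Sum>n<M. d n * v n) + (norm (suminf ?t * g)
     + norm (h * (\<Sum>n. ?t n * cis (real n * x))) + norm (h' * (\<Sum>n. ?t n * cis (- (real n * x)))))"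
    unfolding sums_unique[OF sums, symmetric]
    by (intro norm_triangle_le add_left_mono add_mono norm_triangle_ineq order_refl)
  also have "\<dots> \<le> A * (\<Sum>n<M. real n * norm (d n)) + (A * a12_norm d
     + H * norm (\<Sum>n. ?t n * cis (real n * x)) + H * norm (\<Sum>n. ?t n * cis (- (real n * x))))"
    by (intro add_mono n1 n2 n3 n4)
  finally show "norm (\<Sum>n. d n * v n) \<le> A * (\<Sum>n<M. real n * norm (d n)) + A * a12_norm d
      + H * (norm (\<Sum>n. ?t n * cis (real n * x)) + norm (\<Sum>n. tail_from M (\<lambda>n. cnj (d n)) n * cis (real n * x)))"
    unfolding cnj by (simp add: algebra_simps)
qed

text \<open>
  Satisfied by the Dirichlet kernel and by the kernel of the remainder of the sine series.
\<close>

definition admissible_kernel :: "real \<Rightarrow> (nat \<Rightarrow> real \<Rightarrow> complex) \<Rightarrow> bool" where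
  "admissible_kernel A K \<longleftrightarrow> A \<ge> 0 \<and>
     (\<forall>n\<ge>1. \<forall>x\<in>{0<..pi}. norm (K n x) \<le> A * real n) \<and>
     (\<forall>x\<in>{0<..pi}. \<exists>g h h'. norm g \<le> A \<and> norm h \<le> A / x \<and> norm h' \<le> A / x \<and>
        (\<forall>n. pi / 2 \<le> real n * x \<longrightarrow>
           K n x = g + h * cis (real n * x) + h' * cis (- (real n * x))))"

text \<open>The lower bound on \<open>x\<close> gives \<open>n * x \<ge> pi / 2\<close> for all
  \<open>n \<ge> 2^k\<close>, so the series can be cut at \<open>2^k\<close>; it also bounds
  \<open>1 / x\<close> by \<open>2^Suc k / pi\<close>.\<close>

lemma admissible_kernel_series_dyadic:
  assumes K: "admissible_kernel A K" and d: "in_a12 d" "d 0 = 0"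
    and x: "pi / 2^Suc k < x" "x \<le> pi / 2^k"
  shows "summable (\<lambda>n. norm (d n * K n x)) \<and>
    norm (\<Sum>n. d n * K n x) \<le> A * (\<Sum>n<2^k. real n * norm (d n)) + A * a12_norm d
      + A * 2^Suc k / pi * (norm (\<Sum>n. tail_from (2^k) d n * cis (real n * x))
          + norm (\<Sum>n. tail_from (2^k) (\<lambda>n. cnj (d n)) n * cis (real n * x)))"
proof -
  have "0 < pi / 2^Suc k" by simp
  moreover have "pi / 2^k \<le> pi / 1" by (intro divide_left_mono) auto
  ultimately have x0: "0 < x" "x \<le> pi" using x by linarith+
  have A: "A \<ge> 0" using K by (simp add: admissible_kernel_def)
  have K1: "norm (K n x) \<le> A * real n" if "n < 2^k" "n \<ge> 1" for n
    using K x0 that(2) by (simp add: admissible_kernel_def)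
  have "\<exists>g h h'. norm g \<le> A \<and> norm h \<le> A / x \<and> norm h' \<le> A / x \<and>
      (\<forall>n. pi / 2 \<le> real n * x \<longrightarrow> K n x = g + h * cis (real n * x) + h' * cis (- (real n * x)))"
    using K x0 unfolding admissible_kernel_def by simp
  then obtain g h h' where g: "norm g \<le> A" and h: "norm h \<le> A / x" and h': "norm h' \<le> A / x"
    and gh: "\<And>n. pi / 2 \<le> real n * x \<Longrightarrow> K n x = g + h * cis (real n * x) + h' * cis (- (real n * x))"
    by auto
  have "A / x \<le> A / (pi / 2^Suc k)"
    using x x0 A by (intro divide_left_mono) (auto simp del: power_Suc)
  then have H: "A / x \<le> A * 2^Suc k / pi" by simp
  have K2: "K n x = g + h * cis (real n * x) + h' * cis (- (real n * x))" if "n \<ge> 2^k" for n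
  proof (rule gh)
    have "pi / 2 = 2^k * (pi / 2^Suc k)" by simp
    also have "\<dots> \<le> real n * x"
    proof (rule mult_mono)
      show "2^k \<le> real n" using of_nat_mono[OF that, where 'a=real] by simp
    qed (use x in auto)
    finally show "pi / 2 \<le> real n * x" .
  qed
  show ?thesis
    by (intro conjI summable_kernel_series[OF d K2]
      norm_kernel_series_le[OF d A K1 K2 g order_trans[OF h H] order_trans[OF h' H]])
qed

lemma admissible_kernel_series_summable:
  assumes "admissible_kernel A K" "in_a12 d" "d 0 = 0" and x: "0 < x" "x \<le> pi"
  shows "summable (\<lambda>n. norm (d n * K n x))"
proof -
  obtain k where "pi / 2^Suc k < x" "x \<le> pi / 2^k" by (rule dyadic_interval_ex[OF x])
  from admissible_kernel_series_dyadic[OF assms(1-3) this] show ?thesis ..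
qed

text \<open>The pointwise bound is integrated over each dyadic interval \<open>I k\<close>, and the
  results are summed over \<open>k\<close>.\<close>

lemma nn_integral_admissible_kernel_series_le:
  assumes K: "admissible_kernel A K" and d: "in_a12 d" "d 0 = 0"
  shows "(\<integral>\<^sup>+x\<in>{0<..pi}. ennreal (norm (\<Sum>n. d n * K n x)) \<partial>lborel) \<le> ennreal (7 * pi * A * a12_norm d)"
proof -
  have A: "A \<ge> 0" using K by (simp add: admissible_kernel_def)
  define S where "S k x = norm (\<Sum>n. tail_from (2^k) d n * cis (real n * x))" for k x
  define S' where "S' k x = norm (\<Sum>n. tail_from (2^k) (\<lambda>n. cnj (d n)) n * cis (real n * x))" for k x
  define W where "W k = (\<Sum>n<2^k. real n * norm (d n))" for k :: nat
  define q where "q k = A * 2^Suc k / pi" for k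
  define u where "u k x = A * W k + A * a12_norm d + q k * (S k x + S' k x)" for k x
  define I where "I k = {pi / 2^Suc k<..pi / 2^k}" for k :: nat
  \<comment> \<open>\<open>I k\<close> has length \<open>pi / 2^Suc k\<close>. In the last summand
    the factor \<open>q k\<close> cancels the \<open>2^k\<close> in the mean values of the two
    exponential tails: \<open>2 * (5/4) * 2 = 5\<close>.\<close>
  define c where "c k = (A * W k + A * a12_norm d) * (pi / 2^Suc k) + 5 * pi * A * a12_term d k" for k
  have q0: "q k \<ge> 0" for k using A by (simp add: q_def)
  have W0: "W k \<ge> 0" for k by (simp add: W_def sum_nonneg)
  have a0: "0 \<le> a12_norm d" by (rule a12_norm_nonneg[OF d(1)])
  have I_pos: "0 < x" if "x \<in> I k" for x k
    using that order_less_trans[of 0 "pi / 2^Suc k" x] by (simp add: I_def)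
  have *: "norm (\<Sum>n. d n * K n x) \<le> u k x" if "x \<in> I k" for k x
    using admissible_kernel_series_dyadic[OF K d, of k x] that
    unfolding u_def W_def S_def S'_def q_def I_def by simp
  have S_meas [measurable]: "S k \<in> borel_measurable borel" "S' k \<in> borel_measurable borel" for k
    unfolding S_def S'_def cis_conv_exp by measurable
  have I_meas [measurable]: "I k \<in> sets borel" for k by (simp add: I_def)
  have SI: "(\<integral>\<^sup>+x. ennreal (S k x) * indicator (I k) x \<partial>lborel) \<le> ennreal (5 / 4 * pi\<^sup>2 * a12_term d k / 2^k)" for k
  proof -
    have "(\<integral>\<^sup>+x. ennreal (S k x) * indicator (I k) x \<partial>lborel) \<le> (\<integral>\<^sup>+x\<in>{0..pi / 2^k}. ennreal (S k x) \<partial>lborel)"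
      using I_pos by (intro nn_integral_mono mult_left_mono) (auto split: split_indicator simp: I_def less_imp_le)
    also have "\<dots> \<le> ennreal (5 / 4 * pi\<^sup>2 * a12_term d k / 2^k)"
      unfolding S_def by (rule nn_integral_tail_le[OF d])
    finally show ?thesis .
  qed
  have c: "in_a12 (\<lambda>n. cnj (d n))" "a12_term (\<lambda>n. cnj (d n)) = a12_term d"
    using d(1) in_a12_cong[of d "\<lambda>n. cnj (d n)"] a12_term_cong[of d "\<lambda>n. cnj (d n)"] by auto
  have SI': "(\<integral>\<^sup>+x. ennreal (S' k x) * indicator (I k) x \<partial>lborel) \<le> ennreal (5 / 4 * pi\<^sup>2 * a12_term d k / 2^k)" for k
  proof -
    have "(\<integral>\<^sup>+x. ennreal (S' k x) * indicator (I k) x \<partial>lborel) \<le> (\<integral>\<^sup>+x\<in>{0..pi / 2^k}. ennreal (S' k x) \<partial>lborel)"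
      using I_pos by (intro nn_integral_mono mult_left_mono) (auto split: split_indicator simp: I_def less_imp_le)
    also have "\<dots> \<le> ennreal (5 / 4 * pi\<^sup>2 * a12_term (\<lambda>n. cnj (d n)) k / 2^k)"
      unfolding S'_def using d(2) by (intro nn_integral_tail_le c) simp
    finally show ?thesis by (simp add: c)
  qed
  have uI: "(\<integral>\<^sup>+x. ennreal (u k x) * indicator (I k) x \<partial>lborel) \<le> ennreal (c k)" for k
  proof -
    have S0: "0 \<le> S k x" "0 \<le> S' k x" for x by (simp_all add: S_def S'_def)
    have "(\<integral>\<^sup>+x. ennreal (u k x) * indicator (I k) x \<partial>lborel)
       = (\<integral>\<^sup>+x. ennreal (A * W k + A * a12_norm d) * indicator (I k) x
          + ennreal (q k) * (ennreal (S k x) * indicator (I k) x + ennreal (S' k x) * indicator (I k) x) \<partial>lborel)"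
    proof (intro nn_integral_cong)
      fix x
      have "ennreal (u k x) = ennreal (A * W k + A * a12_norm d) + ennreal (q k) * (ennreal (S k x) + ennreal (S' k x))"
        unfolding u_def using S0[of x] A W0 a0 q0 by (simp add: ennreal_mult[symmetric] ennreal_plus[symmetric] del: ennreal_plus)
      then show "ennreal (u k x) * indicator (I k) x = ennreal (A * W k + A * a12_norm d) * indicator (I k) x
          + ennreal (q k) * (ennreal (S k x) * indicator (I k) x + ennreal (S' k x) * indicator (I k) x)"
        by (auto split: split_indicator)
    qed
    also have "\<dots> = ennreal (A * W k + A * a12_norm d) * emeasure lborel (I k)
       + ennreal (q k) * ((\<integral>\<^sup>+x. ennreal (S k x) * indicator (I k) x \<partial>lborel) + (\<integral>\<^sup>+x. ennreal (S' k x) * indicator (I k) x \<partial>lborel))"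
      by (simp add: nn_integral_add nn_integral_cmult nn_integral_cmult_indicator)
    also have "emeasure lborel (I k) = ennreal (pi / 2^Suc k)"
      unfolding I_def by (subst emeasure_lborel_Ioc) (auto simp: field_simps)
    also have "ennreal (A * W k + A * a12_norm d) * ennreal (pi / 2^Suc k)
       + ennreal (q k) * ((\<integral>\<^sup>+x. ennreal (S k x) * indicator (I k) x \<partial>lborel) + (\<integral>\<^sup>+x. ennreal (S' k x) * indicator (I k) x \<partial>lborel))
      \<le> ennreal (A * W k + A * a12_norm d) * ennreal (pi / 2^Suc k)
       + ennreal (q k) * (ennreal (5 / 4 * pi\<^sup>2 * a12_term d k / 2^k) + ennreal (5 / 4 * pi\<^sup>2 * a12_term d k / 2^k))"
      by (intro add_left_mono mult_left_mono add_mono SI SI') auto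
    also have "\<dots> = ennreal ((A * W k + A * a12_norm d) * (pi / 2^Suc k) + q k * (5 / 4 * pi\<^sup>2 * a12_term d k / 2^k + 5 / 4 * pi\<^sup>2 * a12_term d k / 2^k))"
      using A W0[of k] a0 q0[of k] a12_term_nonneg[OF d(1), of k]
      by (simp add: ennreal_mult[symmetric] ennreal_plus[symmetric] del: ennreal_plus)
    also have "q k * (5 / 4 * pi\<^sup>2 * a12_term d k / 2^k + 5 / 4 * pi\<^sup>2 * a12_term d k / 2^k) = 5 * pi * A * a12_term d k"
      by (simp add: q_def field_simps power2_eq_square)
    finally show ?thesis by (simp add: c_def)
  qed
  have c0: "c k \<ge> 0" for k using A W0[of k] a0 a12_term_nonneg[OF d(1), of k] by (simp add: c_def)
  have csum: "(\<Sum>k<M. c k) \<le> 7 * pi * A * a12_norm d" for M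
  proof -
    have "(\<Sum>k<M. c k) = pi * A / 2 * (\<Sum>k<M. W k / 2^k) + pi * A / 2 * a12_norm d * (\<Sum>k<M. (1/2)^k) + 5 * pi * A * (\<Sum>k<M. a12_term d k)"
      unfolding sum_distrib_left sum.distrib[symmetric] c_def
      by (intro sum.cong refl) (simp add: field_simps power_one_over)
    \<comment> \<open>The heads, the constant parts and the exponential tails contribute 1, 1 and 5
      times \<open>pi * A * a12_norm d\<close>.\<close>
    also have "\<dots> \<le> pi * A / 2 * (2 * a12_norm d) + pi * A / 2 * a12_norm d * 2 + 5 * pi * A * a12_norm d"
    proof (intro add_mono mult_left_mono)
      show "(\<Sum>k<M. W k / 2^k) \<le> 2 * a12_norm d" unfolding W_def by (rule sum_weighted_dyadic_le[OF d(1)])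
      show "(\<Sum>k<M. (1/2::real)^k) \<le> 2"
        by (subst sum_gp_strict) (simp add: field_simps)
      show "(\<Sum>k<M. a12_term d k) \<le> a12_norm d" by (rule sum_a12_term_le_norm[OF d(1)])
    qed (use A a0 in auto)
    finally show ?thesis by (simp add: mult_ac)
  qed
  have "(\<integral>\<^sup>+x\<in>{0<..pi}. ennreal (norm (\<Sum>n. d n * K n x)) \<partial>lborel)
      \<le> (\<integral>\<^sup>+x. (\<Sum>k. ennreal (u k x) * indicator (I k) x) \<partial>lborel)"
  proof (intro nn_integral_mono)
    fix x
    show "ennreal (norm (\<Sum>n. d n * K n x)) * indicator {0<..pi} x \<le> (\<Sum>k. ennreal (u k x) * indicator (I k) x)"
    proof (cases "x \<in> {0<..pi}")
      case True
      then obtain k where k: "x \<in> I k" using dyadic_interval_ex[of x] by (auto simp: I_def)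
      have single_le: "w k \<le> suminf w" for w :: "nat \<Rightarrow> ennreal"
        using sum_le_suminf[of w "{k}"] by simp
      have "ennreal (norm (\<Sum>n. d n * K n x)) * indicator {0<..pi} x \<le> ennreal (u k x) * indicator (I k) x"
        using *[OF k] k True by (auto intro: ennreal_leI)
      also have "\<dots> \<le> (\<Sum>k. ennreal (u k x) * indicator (I k) x)"
        by (rule single_le)
      finally show ?thesis .
    qed simp
  qed
  also have "\<dots> = (\<Sum>k. \<integral>\<^sup>+x. ennreal (u k x) * indicator (I k) x \<partial>lborel)"
    unfolding u_def by (intro nn_integral_suminf) measurable
  also have "\<dots> \<le> (\<Sum>k. ennreal (c k))"
    by (intro suminf_le uI) auto
  also have "\<dots> \<le> ennreal (7 * pi * A * a12_norm d)"
    by (intro suminf_le_const) (auto simp: sum_ennreal c0 csum intro!: ennreal_leI)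
  finally show ?thesis .
qed

section \<open>Tails of a sequence in the space\<close>

lemma a12_block_tail_le: "a12_block (tail_from M d) m j \<le> a12_block d m j"
  unfolding a12_block_def by (intro sum_mono) (simp add: tail_from_def)

lemma summable_a12_block_tail_squared:
  assumes "in_a12 d"
  shows "summable (\<lambda>i. (a12_block (tail_from M d) m (Suc i))\<^sup>2)"
proof (rule summable_comparison_test')
  show "summable (\<lambda>i. (a12_block d m (Suc i))\<^sup>2)" using assms by (simp add: in_a12_def)
  show "norm ((a12_block (tail_from M d) m (Suc i))\<^sup>2) \<le> (a12_block d m (Suc i))\<^sup>2" if "i \<ge> 0" for i
    by (simp add: power_mono a12_block_tail_le a12_block_nonneg)
qed

lemma a12_term_tail_le:
  assumes "in_a12 d"
  shows "a12_term (tail_from M d) m \<le> a12_term d m"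
  unfolding a12_term_def
  using assms by (intro real_sqrt_le_mono suminf_le power_mono a12_block_tail_le a12_block_nonneg
      summable_a12_block_tail_squared) (auto simp: in_a12_def)

lemma in_a12_tail_from:
  assumes "in_a12 d"
  shows "in_a12 (tail_from M d)"
proof -
  have nonneg: "0 \<le> a12_term (tail_from M d) m" for m
    unfolding a12_term_def by (simp add: suminf_nonneg summable_a12_block_tail_squared[OF assms])
  have "summable (a12_term d)" using assms by (simp add: in_a12_def)
  then have "summable (a12_term (tail_from M d))"
    by (rule summable_comparison_test'[where N=0]) (simp add: nonneg a12_term_tail_le[OF assms])
  then show ?thesis by (simp add: in_a12_def summable_a12_block_tail_squared[OF assms])
qed

text \<open>Dominated convergence for series, used twice: each fixed block eventually vanishes and
  is dominated by the block of \<open>d\<close>, and then each fixed level tends to 0 and is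
  dominated by the level of \<open>d\<close>.\<close>

lemma a12_norm_tail_tendsto_0:
  assumes d: "in_a12 d"
  shows "(\<lambda>M. a12_norm (tail_from M d)) \<longlonglongrightarrow> 0"
proof -
  have s: "summable (\<lambda>i. (a12_block d m (Suc i))\<^sup>2)" "summable (a12_term d)" for m
    using d by (auto simp: in_a12_def)
  have blk: "(\<lambda>M. (a12_block (tail_from M d) m (Suc i))\<^sup>2) \<longlonglongrightarrow> 0" for m i
  proof (rule tendsto_eventually, rule eventually_sequentiallyI)
    fix M assume M: "(Suc i + 1) * 2^m \<le> M"
    have "n < M" if "n \<le> (Suc i + 1) * 2^m - 1" for n
    proof -
      have "0 < (Suc i + 1) * 2^m" by simp
      with that M show ?thesis by linarith
    qed
    then show "(a12_block (tail_from M d) m (Suc i))\<^sup>2 = 0"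
      unfolding a12_block_def tail_from_def by (simp del: mult_Suc)
  qed
  have term0: "(\<lambda>M. a12_term (tail_from M d) m) \<longlonglongrightarrow> 0" for m
  proof -
    have "(\<lambda>M. \<Sum>i. (a12_block (tail_from M d) m (Suc i))\<^sup>2) \<longlonglongrightarrow> (\<Sum>i::nat. 0)"
      using tannerys_theorem[where a="\<lambda>i M. (a12_block (tail_from M d) m (Suc i))\<^sup>2", OF blk _ s(1)[of m]]
      by (auto simp: a12_block_nonneg intro!: always_eventually power_mono a12_block_tail_le)
    from tendsto_real_sqrt[OF this] show ?thesis by (simp add: a12_term_def)
  qed
  have "(\<lambda>M. \<Sum>m. a12_term (tail_from M d) m) \<longlonglongrightarrow> (\<Sum>m::nat. 0)"
    using tannerys_theorem[where a="\<lambda>m M. a12_term (tail_from M d) m", OF term0 _ s(2)]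
    by (auto intro!: always_eventually simp: a12_term_tail_le d a12_term_nonneg in_a12_tail_from)
  then show ?thesis by (simp add: a12_norm_def)
qed

subsection \<open>Dirichlet kernels\<close>

definition dirichlet :: "nat \<Rightarrow> real \<Rightarrow> real" where
  "dirichlet n x = 1 / 2 + (\<Sum>k=1..n. cos (real k * x))"

definition conj_dirichlet :: "nat \<Rightarrow> real \<Rightarrow> real" where
  "conj_dirichlet n x = (\<Sum>k=1..n. sin (real k * x))"

text \<open>The product-to-sum formula makes the sum telescope. The form without division also
  covers the zeros of \<open>sin (x / 2)\<close>.\<close>

lemma dirichlet_closed: "2 * sin (x / 2) * dirichlet n x = sin (real n * x + x / 2)"
proof (induction n)
  case (Suc n)
  have "2 * sin (x/2) * cos (real (Suc n) * x) = sin (real (Suc n) * x + x/2) - sin (real n * x + x/2)"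
    using sin_diff[of "real (Suc n) * x" "x/2"] sin_add[of "real (Suc n) * x" "x/2"]
    by (simp add: algebra_simps)
  then show ?case using Suc by (simp add: dirichlet_def algebra_simps)
qed (simp add: dirichlet_def)

lemma conj_dirichlet_closed: "2 * sin (x / 2) * conj_dirichlet n x = cos (x / 2) - cos (real n * x + x / 2)"
proof (induction n)
  case (Suc n)
  have "2 * sin (x/2) * sin (real (Suc n) * x) = cos (real n * x + x/2) - cos (real (Suc n) * x + x/2)"
    using cos_diff[of "real (Suc n) * x" "x/2"] cos_add[of "real (Suc n) * x" "x/2"]
    by (simp add: algebra_simps)
  then show ?case using Suc by (simp add: conj_dirichlet_def algebra_simps)
qed (simp add: conj_dirichlet_def)

lemma sin_half_ge:
  assumes "0 \<le> x" "x \<le> pi"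
  shows "x / pi \<le> sin (x / 2)"
  using sin_ge_linear[of "x / 2"] assms by simp

lemma sin_half_pos: "0 < x \<Longrightarrow> x \<le> pi \<Longrightarrow> 0 < sin (x / 2)"
  by (intro sin_gt_zero) auto

lemma norm_dirichlet_le: "n \<ge> 1 \<Longrightarrow> \<bar>dirichlet n x\<bar> \<le> 2 * real n"
proof -
  assume "n \<ge> 1"
  have "\<bar>\<Sum>k=1..n. cos (real k * x)\<bar> \<le> (\<Sum>k=1..n. 1)"
    by (intro order_trans[OF sum_abs] sum_mono) auto
  with \<open>n \<ge> 1\<close> show ?thesis unfolding dirichlet_def by simp
qed

lemma norm_conj_dirichlet_le: "\<bar>conj_dirichlet n x\<bar> \<le> real n"
proof -
  have "\<bar>conj_dirichlet n x\<bar> \<le> (\<Sum>k=1..n. 1)"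
    unfolding conj_dirichlet_def by (intro order_trans[OF sum_abs] sum_mono) auto
  then show ?thesis by simp
qed

lemma dirichlet_cis:
  assumes "0 < x" "x \<le> pi"
  shows "complex_of_real (dirichlet n x) = cis (x/2) / (4 * \<i> * sin (x/2)) * cis (real n * x)
      + (- cis (-(x/2)) / (4 * \<i> * sin (x/2))) * cis (- (real n * x))"
proof -
  have s: "sin (x/2) \<noteq> 0" using sin_half_pos[OF assms] by simp
  have d: "dirichlet n x = sin (real n * x + x/2) / (2 * sin (x/2))"
    using dirichlet_closed[of x n] s by (simp add: field_simps)
  have eq: "cis (x/2) * cis (real n * x) - cis (-(x/2)) * cis (- (real n * x)) = 2 * \<i> * sin (real n * x + x/2)"
  proof -
    have "cis t - cis (-t) = 2 * \<i> * sin t" for t by (simp add: complex_eq_iff)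
    from this[of "real n * x + x/2"] show ?thesis by (simp add: cis_mult add.commute)
  qed
  have "cis (x/2) / (4 * \<i> * sin (x/2)) * cis (real n * x) + (- cis (-(x/2)) / (4 * \<i> * sin (x/2))) * cis (- (real n * x))
      = (cis (x/2) * cis (real n * x) - cis (-(x/2)) * cis (- (real n * x))) / (4 * \<i> * sin (x/2))"
    by (simp add: diff_divide_distrib)
  also have "\<dots> = of_real (dirichlet n x)"
    unfolding eq d using s by simp
  finally show ?thesis ..
qed

text \<open>Unlike for the Dirichlet kernel, there is a constant part, half the cotangent of
  \<open>x / 2\<close>. It is of size \<open>1 / x\<close> near 0, the singularity that the main
  term of the sine series removes.\<close>

lemma conj_dirichlet_cis:
  assumes "0 < x" "x \<le> pi"
  shows "complex_of_real (conj_dirichlet n x) = complex_of_real (cos (x/2) / (2 * sin (x/2)))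
      + (- cis (x/2) / (4 * sin (x/2))) * cis (real n * x)
      + (- cis (-(x/2)) / (4 * sin (x/2))) * cis (- (real n * x))"
proof -
  have s: "sin (x/2) \<noteq> 0" using sin_half_pos[OF assms] by simp
  have d: "conj_dirichlet n x = (cos (x/2) - cos (real n * x + x/2)) / (2 * sin (x/2))"
    using conj_dirichlet_closed[of x n] s by (simp add: field_simps)
  have eq: "cis (x/2) * cis (real n * x) + cis (-(x/2)) * cis (- (real n * x)) = 2 * cos (real n * x + x/2)"
  proof -
    have "cis t + cis (-t) = 2 * cos t" for t by (simp add: complex_eq_iff)
    from this[of "real n * x + x/2"] show ?thesis by (simp add: cis_mult add.commute)
  qed
  have "complex_of_real (cos (x/2) / (2 * sin (x/2))) + (- cis (x/2) / (4 * sin (x/2))) * cis (real n * x)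
        + (- cis (-(x/2)) / (4 * sin (x/2))) * cis (- (real n * x))
      = complex_of_real (cos (x/2) / (2 * sin (x/2)))
        - (cis (x/2) * cis (real n * x) + cis (-(x/2)) * cis (- (real n * x))) / (4 * sin (x/2))"
    by (simp add: add_divide_distrib)
  also have "\<dots> = of_real (conj_dirichlet n x)"
    unfolding eq d using s by (simp add: diff_divide_distrib)
  finally show ?thesis ..
qed

lemma norm_cis_div_sin_half_le:
  assumes "0 < x" "x \<le> pi" "norm z = 1"
  shows "norm (z / (4 * complex_of_real (sin (x/2)))) \<le> 1 / x"
proof -
  have s: "0 < sin (x/2)" "x / pi \<le> sin (x/2)" using sin_half_ge[of x] sin_half_pos[of x] assms by auto
  have "norm (z / (4 * complex_of_real (sin (x/2)))) = 1 / (4 * sin (x/2))"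
    using assms(3) s by (simp add: norm_divide norm_mult)
  also have "\<dots> \<le> 1 / (4 * (x / pi))"
    using s assms by (intro divide_left_mono mult_left_mono mult_pos_pos) auto
  also have "\<dots> \<le> 1 / x" using assms pi_less_4 by (simp add: field_simps)
  finally show ?thesis .
qed

text \<open>With \<open>t = x / 2\<close> and \<open>x \<le> pi / 2\<close> the difference is
  \<open>(t * cos t - sin t) / (2 * t * sin t)\<close>: the numerator is of order
  \<open>t^3\<close>, the denominator of order \<open>t^2\<close>. For larger \<open>x\<close> both
  terms lie in \<open>[0, 1]\<close>.\<close>

lemma cot_half_minus_inverse_le:
  assumes x: "0 < x" "x \<le> pi"
  shows "\<bar>cos (x/2) / (2 * sin (x/2)) - min 1 (pi / (2 * x)) / x\<bar> \<le> 1"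
proof -
  define t where "t = x / 2"
  have t: "0 < t" "t \<le> pi / 2" "x = 2 * t" using x by (auto simp: t_def)
  have s: "2 / pi * t \<le> sin t" using t by (intro sin_ge_linear) auto
  have s0: "sin t > 0" using t by (intro sin_gt_zero) auto
  show ?thesis
  proof (cases "x \<le> pi / 2")
    case True
    then have m: "min 1 (pi / (2 * x)) = 1" using x by (simp add: field_simps)
    have 1: "sin t - t * cos t \<le> t * (t\<^sup>2 / 2)"
    proof -
      have "sin t \<le> t" using t by (intro sin_x_le_x) auto
      moreover have "1 - t\<^sup>2 / 2 \<le> cos t"
      proof -
        have "(sin (t/2))\<^sup>2 \<le> (t/2)\<^sup>2" by (rule abs_le_square_iff[THEN iffD1], rule abs_sin_x_le_abs_x)
        then show ?thesis using cos_double_sin[of "t/2"] by (simp add: power_divide)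
      qed
      then have "t * (1 - t\<^sup>2 / 2) \<le> t * cos t" using t by (intro mult_left_mono) auto
      ultimately show ?thesis by (simp add: algebra_simps)
    qed
    \<comment> \<open>The derivative of \<open>sin t - t * cos t\<close> is
      \<open>t * sin t\<close>.\<close>
    have 2: "0 \<le> sin t - t * cos t"
    proof -
      have "sin 0 - 0 * cos 0 \<le> sin t - t * cos (t::real)"
        by (rule DERIV_nonneg_imp_nondecreasing[of 0 t "\<lambda>t. sin t - t * cos t"])
           (use t in \<open>auto intro!: exI derivative_eq_intros mult_nonneg_nonneg sin_ge_zero\<close>)
      then show ?thesis by simp
    qed
    have eq: "cos (x/2) / (2 * sin (x/2)) - min 1 (pi / (2 * x)) / x = - ((sin t - t * cos t) / (2 * t * sin t))"
      unfolding m unfolding t(3) using t(1) s0 by (simp add: field_simps)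
    have "(sin t - t * cos t) / (2 * t * sin t) \<le> (t * (t\<^sup>2 / 2)) / (2 * t * (2 / pi * t))"
      using 1 2 s t by (intro frac_le mult_left_mono) auto
    also have "\<dots> = pi * t / 8" using t by (simp add: field_simps power2_eq_square)
    also have "\<dots> \<le> 4 * 2 / 8"
      using t pi_less_4 by (intro divide_right_mono mult_mono) auto
    finally show ?thesis unfolding eq using 2 t s0 by simp
  next
    case False
    have "1 / 2 \<le> x / pi" using False by (simp add: field_simps)
    then have "1 / 2 \<le> sin (x/2)" using sin_half_ge[of x] x by linarith
    moreover have "0 \<le> cos (x/2)" using x by (intro cos_ge_zero) auto
    ultimately have "0 \<le> cos (x/2) / (2 * sin (x/2))" "cos (x/2) / (2 * sin (x/2)) \<le> 1"
      using cos_le_one[of "x/2"] by (auto simp: field_simps intro: order_trans[of _ 1])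
    moreover have "0 \<le> min 1 (pi / (2 * x)) / x" "min 1 (pi / (2 * x)) / x \<le> 1"
    proof -
      have "1 \<le> x" using False pi_ge_two by linarith
      then show "min 1 (pi / (2 * x)) / x \<le> 1" "0 \<le> min 1 (pi / (2 * x)) / x" by (auto simp: field_simps)
    qed
    ultimately show ?thesis by linarith
  qed
qed

section \<open>Interpolation of a cutoff\<close>

text \<open>If \<open>b\<close> tends to 0 and \<open>b 0 = 0\<close>, then \<open>b j\<close> is
  the sum of \<open>Delta b n * cutoff n j\<close> over \<open>n\<close>. Interpolation is linear,
  so \<open>interp b\<close> is the same combination of interpolated cutoffs.\<close>

definition cutoff :: "nat \<Rightarrow> nat \<Rightarrow> complex" where
  "cutoff n j = (if 1 \<le> j \<and> j \<le> n then 1 else 0)"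

text \<open>The value is a convex combination of two neighbouring values, each 0 or 1.\<close>

lemma norm_interp_cutoff_le: "norm (interp (cutoff n) y) \<le> 1" if "y \<ge> 0"
proof -
  define m where "m = nat \<lfloor>y\<rfloor>"
  have m: "real m \<le> y" "y < real m + 1" using that by (simp_all add: m_def)
  have c: "norm (cutoff n j) \<le> 1" for j by (simp add: cutoff_def)
  have "interp (cutoff n) y = of_real (1 - (y - real m)) * cutoff n m + of_real (y - real m) * cutoff n (m + 1)"
    by (simp add: interp_def Let_def m_def Delta_def algebra_simps)
  also have "norm \<dots> \<le> (1 - (y - real m)) * 1 + (y - real m) * 1"
    using m c by (intro norm_triangle_le add_mono) (auto simp only: norm_mult norm_of_real norm_ge_zero intro!: mult_mono)
  finally show ?thesis by simp
qed

lemma interp_cutoff_eq_0: "interp (cutoff n) y = 0" if "y \<ge> real n + 1"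
proof -
  have "nat \<lfloor>y\<rfloor> > n" using that by linarith
  then show ?thesis by (simp add: interp_def Let_def Delta_def cutoff_def)
qed

lemma interp_cutoff_eq_min: "interp (cutoff n) y = of_real (min 1 y)" if "0 < y" "y \<le> real n"
proof -
  have n: "n \<ge> 1" using that by (cases n) auto
  show ?thesis
  proof (cases "y \<le> 1")
    case True
    then have "interp (cutoff n) y = cutoff n 0 + of_real (real 0 - y) * Delta (cutoff n) 0"
      using that by (intro interp_eq) auto
    then show ?thesis using n True by (simp add: Delta_def cutoff_def)
  next
    case False
    \<comment> \<open>The ceiling, not the floor, gives \<open>m + 1 \<le> n\<close> also when
      \<open>y = n\<close>, so that both nodes carry the value 1.\<close>
    define m where "m = nat \<lceil>y\<rceil> - 1"
    have m: "real m \<le> y" "y \<le> real m + 1" "1 \<le> m" "m + 1 \<le> n"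
      using False that unfolding m_def by linarith+
    have "interp (cutoff n) y = cutoff n m + of_real (real m - y) * Delta (cutoff n) m"
      using m by (intro interp_eq) auto
    then show ?thesis using m False by (simp add: Delta_def cutoff_def)
  qed
qed

subsection \<open>The cosine series\<close>

lemma nn_integral_indicator_Icc_0_pi:
  fixes F :: "real \<Rightarrow> complex"
  shows "(\<integral>\<^sup>+x. ennreal (norm (indicat_real {0..pi} x *\<^sub>R F x)) \<partial>lborel)
      = (\<integral>\<^sup>+x\<in>{0<..pi}. ennreal (norm (F x)) \<partial>lborel)"
  using AE_lborel_singleton[of "0::real"]
  by (intro nn_integral_cong_AE) (auto split: split_indicator)

lemma integrable_from_nn_integral_bound:
  fixes F :: "real \<Rightarrow> complex"
  assumes F [measurable]: "F \<in> borel_measurable borel"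
    and le: "(\<integral>\<^sup>+x\<in>{0<..pi}. ennreal (norm (F x)) \<partial>lborel) \<le> ennreal B"
  shows "integrable lborel (\<lambda>x. indicat_real {0..pi} x *\<^sub>R F x)"
proof (rule integrableI_bounded)
  show "(\<integral>\<^sup>+x. ennreal (norm (indicat_real {0..pi} x *\<^sub>R F x)) \<partial>lborel) < \<infinity>"
    unfolding nn_integral_indicator_Icc_0_pi using le_less_trans[OF le, of \<infinity>] by simp
qed measurable

lemma set_integrable_from_nn_integral_bound:
  fixes F :: "real \<Rightarrow> complex"
  assumes F [measurable]: "F \<in> borel_measurable borel"
    and le: "(\<integral>\<^sup>+x\<in>{0<..pi}. ennreal (norm (F x)) \<partial>lborel) \<le> ennreal B"
  shows "set_integrable lebesgue {0..pi} F"
  unfolding set_integrable_def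
  using integrable_from_nn_integral_bound[OF assms] by (subst integrable_completion) auto

lemma integral_norm_from_nn_integral_bound:
  fixes F :: "real \<Rightarrow> complex"
  assumes F [measurable]: "F \<in> borel_measurable borel" and B: "B \<ge> 0"
    and le: "(\<integral>\<^sup>+x\<in>{0<..pi}. ennreal (norm (F x)) \<partial>lborel) \<le> ennreal B"
  shows "(LINT x:{0..pi}|lebesgue. norm (F x)) \<le> B"
proof -
  have "(LINT x:{0..pi}|lebesgue. norm (F x)) = (LINT x|lborel. norm (indicat_real {0..pi} x *\<^sub>R F x))"
    unfolding set_lebesgue_integral_def by (subst integral_completion) (auto intro!: Bochner_Integration.integral_cong)
  moreover have "ennreal (LINT x|lborel. norm (indicat_real {0..pi} x *\<^sub>R F x)) \<le> ennreal B"
    using nn_integral_eq_integral[OF integrable_norm[OF integrable_from_nn_integral_bound[OF F le]]]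
      le nn_integral_indicator_Icc_0_pi[of F] by simp
  ultimately show ?thesis using B by simp
qed

lemma norm_integral_from_nn_integral_bound:
  fixes F :: "real \<Rightarrow> complex"
  assumes F: "F \<in> borel_measurable borel" and B: "B \<ge> 0"
    and le: "(\<integral>\<^sup>+x\<in>{0<..pi}. ennreal (norm (F x)) \<partial>lborel) \<le> ennreal B"
  shows "norm (LINT x:{0..pi}|lebesgue. F x) \<le> B"
proof -
  have "norm (LINT x:{0..pi}|lebesgue. F x) \<le> (LINT x|lebesgue. norm (indicat_real {0..pi} x *\<^sub>R F x))"
    unfolding set_lebesgue_integral_def by (rule integral_norm_bound)
  also have "\<dots> = (LINT x:{0..pi}|lebesgue. norm (F x))"
    unfolding set_lebesgue_integral_def by (intro Bochner_Integration.integral_cong) auto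
  finally show ?thesis using integral_norm_from_nn_integral_bound[OF assms] by simp
qed

lemma dirichlet_measurable [measurable]: "dirichlet n \<in> borel_measurable borel"
  unfolding dirichlet_def by measurable

lemma conj_dirichlet_measurable [measurable]: "conj_dirichlet n \<in> borel_measurable borel"
  unfolding conj_dirichlet_def by measurable

text \<open>The exponential form has no constant part and coefficients at most \<open>1 / x\<close>;
  the constant 2 comes from \<open>1/2 + n \<le> 2 * n\<close>.\<close>

lemma admissible_dirichlet: "admissible_kernel 2 (\<lambda>n x. complex_of_real (dirichlet n x))"
  unfolding admissible_kernel_def
proof (intro conjI ballI allI impI)
  show "norm (complex_of_real (dirichlet n x)) \<le> 2 * real n" if "n \<ge> 1" for n x
    using norm_dirichlet_le[OF that] by simp
next
  fix x assume "x \<in> {0<..pi}"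
  then have x: "0 < x" "x \<le> pi" by auto
  define h where "h = cis (x/2) / (4 * \<i> * sin (x/2))"
  define h' where "h' = - cis (-(x/2)) / (4 * \<i> * sin (x/2))"
  have "norm (cis (x/2) / \<i>) = 1" "norm (- cis (-(x/2)) / \<i>) = 1" by (simp_all add: norm_divide norm_mult)
  from this[THEN norm_cis_div_sin_half_le[OF x]]
  have "norm h \<le> 1 / x" "norm h' \<le> 1 / x" by (simp_all add: h_def h'_def norm_divide norm_mult)
  moreover have "1 / x \<le> 2 / x" using x by (simp add: divide_right_mono)
  moreover have "complex_of_real (dirichlet n x) = 0 + h * cis (real n * x) + h' * cis (- (real n * x))" for n
    unfolding h_def h'_def using dirichlet_cis[OF x] by simp
  ultimately show "\<exists>g h h'. norm g \<le> 2 \<and> norm h \<le> 2 / x \<and> norm h' \<le> 2 / x \<and>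
      (\<forall>n. pi / 2 \<le> real n * x \<longrightarrow> complex_of_real (dirichlet n x) =
         g + h * cis (real n * x) + h' * cis (- (real n * x)))"
    by (intro exI[of _ 0] exI[of _ h] exI[of _ h']) auto
qed simp

section \<open>Orthogonality of cosines\<close>

lemma has_integral_cos_int:
  "((\<lambda>x. cos (of_int m * x)) has_integral (if m = 0 then pi else 0)) {0..pi}"
proof (cases "m = 0")
  case True
  then show ?thesis using has_integral_const_real[of "1::real" 0 pi] by simp
next
  case False
  have "((\<lambda>x. cos (of_int m * x)) has_integral (sin (of_int m * pi) / of_int m - sin (of_int m * 0) / of_int m)) {0..pi}"
    by (rule fundamental_theorem_of_calculus)
       (use False in \<open>auto intro!: derivative_eq_intros simp flip: has_real_derivative_iff_has_vector_derivative\<close>)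
  moreover have "sin (of_int m * pi) = 0" by (metis Ints_of_int sin_times_pi_eq_0)
  ultimately show ?thesis using False by simp
qed

lemma has_integral_cos_cos:
  fixes j k :: nat
  shows "((\<lambda>x. cos (real j * x) * cos (real k * x)) has_integral
     ((if j = k then pi else 0) + (if j = 0 \<and> k = 0 then pi else 0)) / 2) {0..pi}"
proof -
  have "((\<lambda>x. (cos (of_int (int j - int k) * x) + cos (of_int (int j + int k) * x)) / 2) has_integral
     ((if int j - int k = 0 then pi else 0) + (if int j + int k = 0 then pi else 0)) / 2) {0..pi}"
    by (intro has_integral_divide has_integral_add has_integral_cos_int)
  moreover have "(cos (of_int (int j - int k) * x) + cos (of_int (int j + int k) * x)) / 2 = cos (real j * x) * cos (real k * x)" for x
    by (simp add: cos_times_cos algebra_simps)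
  moreover have "(int j - int k = 0) = (j = k)" "(int j + int k = 0) = (j = 0 \<and> k = 0)" by auto
  ultimately show ?thesis by simp
qed

text \<open>The constant term \<open>1 / 2\<close> of the kernel makes the value for
  \<open>k = 0\<close> agree with that for \<open>1 \<le> k \<le> n\<close>.\<close>

lemma has_integral_dirichlet_cos:
  "((\<lambda>x. dirichlet n x * cos (real k * x)) has_integral (if k \<le> n then pi / 2 else 0)) {0..pi}"
proof -
  have "((\<lambda>x. 1 / 2 * (cos (real 0 * x) * cos (real k * x)) + (\<Sum>j=1..n. cos (real j * x) * cos (real k * x))) has_integral
     (1 / 2 * (((if 0 = k then pi else 0) + (if (0::nat) = 0 \<and> k = 0 then pi else 0)) / 2)
      + (\<Sum>j=1..n. ((if j = k then pi else 0) + (if j = 0 \<and> k = 0 then pi else 0)) / 2))) {0..pi}"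
    by (intro has_integral_add has_integral_mult_right has_integral_sum has_integral_cos_cos) simp
  moreover have "(\<Sum>j=1..n. ((if j = k then pi else 0) + (if j = 0 \<and> k = 0 then pi else 0)) / 2)
      = (\<Sum>j=1..n. if j = k then pi / 2 else 0)"
    by (intro sum.cong) auto
  moreover have "\<dots> = (if 1 \<le> k \<and> k \<le> n then pi / 2 else 0)" by (simp add: sum.delta)
  moreover have "1 / 2 * (((if 0 = k then pi else 0) + (if (0::nat) = 0 \<and> k = 0 then pi else 0)) / 2)
      + (if 1 \<le> k \<and> k \<le> n then pi / 2 else 0) = (if k \<le> n then pi / 2 else 0)"
    by (cases "k = 0") auto
  ultimately show ?thesis
    by (simp only: dirichlet_def distrib_right sum_distrib_right) simp
qed

lemma sum_Delta_from:
  assumes "k \<le> M"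
  shows "(\<Sum>n<M. if k \<le> n then Delta a n else 0) = a k - a M"
  using assms
proof (induction M rule: dec_induct)
  case base
  have "(\<Sum>n<k. if k \<le> n then Delta a n else 0) = 0" by (intro sum.neutral) auto
  then show ?case by simp
qed (simp add: Delta_def)

text \<open>The partial sums \<open>p M\<close> of the series after summation by parts converge to
  \<open>f\<close> in \<open>L^1\<close>, because the remainder is the kernel series of a tail,
  whose norm tends to 0. Fourier coefficients pass to the limit.\<close>

theorem cosine_series_L1:
  assumes a: "a \<longlonglongrightarrow> 0" and d: "in_a12 (Delta a)"
  shows "is_L1_cosine_series a"
proof -
  define D where "D n x = complex_of_real (dirichlet n x)" for n x
  define t where "t M = tail_from (Suc M) (Delta a)" for M
  \<comment> \<open>The term of index 0 is kept apart: the norm does not control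
    \<open>Delta a 0\<close>, and the kernel estimates require a sequence vanishing at 0.\<close>
  define f where "f x = Delta a 0 * D 0 x + (\<Sum>n. t 0 n * D n x)" for x
  define p where "p M x = (\<Sum>n<Suc M. Delta a n * D n x)" for M x
  have t: "in_a12 (t M)" "t M 0 = 0" for M
    using in_a12_tail_from[OF d] by (simp_all add: t_def tail_from_def)
  have D_meas [measurable]: "D n \<in> borel_measurable borel" for n unfolding D_def by measurable
  have f_meas [measurable]: "f \<in> borel_measurable borel" unfolding f_def by measurable
  have p_meas [measurable]: "p M \<in> borel_measurable borel" for M unfolding p_def by measurable
  have rem: "f x - p M x = (\<Sum>n. t M n * D n x)" if "0 < x" "x \<le> pi" for M x
  proof -
    have s: "summable (\<lambda>n. t M n * D n x)"
      unfolding D_def by (rule summable_norm_cancel[OF admissible_kernel_series_summable[OF admissible_dirichlet t that]])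
    have "(\<lambda>n. (if n \<in> {1..<Suc M} then Delta a n * D n x else 0) + t M n * D n x) sums
       ((\<Sum>n=1..<Suc M. Delta a n * D n x) + (\<Sum>n. t M n * D n x))"
      by (intro sums_add sums_If_finite_set summable_sums s) simp
    moreover have "(if n \<in> {1..<Suc M} then Delta a n * D n x else 0) + t M n * D n x = t 0 n * D n x" for n
      by (auto simp: t_def tail_from_def)
    ultimately have "(\<Sum>n. t 0 n * D n x) = (\<Sum>n=1..<Suc M. Delta a n * D n x) + (\<Sum>n. t M n * D n x)"
      by (simp add: sums_iff)
    then show ?thesis
      by (simp add: f_def p_def lessThan_atLeast0 sum.atLeast_Suc_lessThan del: sum.op_ivl_Suc)
  qed
  have rem_le: "(\<integral>\<^sup>+x\<in>{0<..pi}. ennreal (norm (f x - p M x)) \<partial>lborel) \<le> ennreal (14 * pi * a12_norm (t M))" for M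
  proof -
    have "(\<integral>\<^sup>+x\<in>{0<..pi}. ennreal (norm (f x - p M x)) \<partial>lborel)
        = (\<integral>\<^sup>+x\<in>{0<..pi}. ennreal (norm (\<Sum>n. t M n * D n x)) \<partial>lborel)"
      by (intro nn_integral_cong) (auto simp: rem split: split_indicator)
    also have "\<dots> \<le> ennreal (14 * pi * a12_norm (t M))"
      using nn_integral_admissible_kernel_series_le[OF admissible_dirichlet t, of M] by (simp add: D_def)
    finally show ?thesis .
  qed
  have B0: "0 \<le> 14 * pi * a12_norm (t M)" for M using a12_norm_nonneg[OF t(1)] by simp
  have pc: "set_integrable lebesgue {0..pi} (\<lambda>x. p M x * of_real (cos (real k * x)))" for M k
  proof -
    have "continuous_on {0..pi} (\<lambda>x. p M x * of_real (cos (real k * x)))"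
      unfolding p_def D_def dirichlet_def by (intro continuous_intros)
    from borel_integrable_atLeastAtMost'[OF this] show ?thesis
      unfolding set_integrable_def by (subst integrable_completion) auto
  qed
  have rc: "set_integrable lebesgue {0..pi} (\<lambda>x. (f x - p M x) * of_real (cos (real k * x)))"
      "norm (LINT x:{0..pi}|lebesgue. (f x - p M x) * of_real (cos (real k * x))) \<le> 14 * pi * a12_norm (t M)" for M k
  proof -
    have "(\<integral>\<^sup>+x\<in>{0<..pi}. ennreal (norm ((f x - p M x) * of_real (cos (real k * x)))) \<partial>lborel)
       \<le> (\<integral>\<^sup>+x\<in>{0<..pi}. ennreal (norm (f x - p M x)) \<partial>lborel)"
      by (intro nn_integral_mono mult_right_mono ennreal_leI) (auto simp: norm_mult intro!: mult_left_le)
    also note rem_le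
    finally have le: "(\<integral>\<^sup>+x\<in>{0<..pi}. ennreal (norm ((f x - p M x) * of_real (cos (real k * x)))) \<partial>lborel)
      \<le> ennreal (14 * pi * a12_norm (t M))" .
    show "set_integrable lebesgue {0..pi} (\<lambda>x. (f x - p M x) * of_real (cos (real k * x)))"
      by (rule set_integrable_from_nn_integral_bound[OF _ le]) measurable
    show "norm (LINT x:{0..pi}|lebesgue. (f x - p M x) * of_real (cos (real k * x))) \<le> 14 * pi * a12_norm (t M)"
      by (rule norm_integral_from_nn_integral_bound[OF _ B0 le]) measurable
  qed
  have fint: "set_integrable lebesgue {0..pi} f"
    using set_integral_add(1)[OF rc(1)[of 0 0] pc[of 0 0]] by simp
  have fc: "(LINT x:{0..pi}|lebesgue. f x * of_real (cos (real k * x)))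
      = (LINT x:{0..pi}|lebesgue. (f x - p M x) * of_real (cos (real k * x)))
        + (LINT x:{0..pi}|lebesgue. p M x * of_real (cos (real k * x)))" for k M
    using set_integral_add(2)[OF rc(1)[of M k] pc[of M k]] by (simp add: algebra_simps)
  \<comment> \<open>Only kernels of order \<open>n \<ge> k\<close> contribute, each
    \<open>pi / 2\<close> times \<open>Delta a n\<close>, and these differences telescope.\<close>
  have pI: "(LINT x:{0..pi}|lebesgue. p M x * of_real (cos (real k * x))) = of_real (pi / 2) * (a k - a (Suc M))"
    if "k \<le> Suc M" for k M
  proof -
    have "((\<lambda>x. \<Sum>n<Suc M. Delta a n * of_real (dirichlet n x * cos (real k * x))) has_integral
        (\<Sum>n<Suc M. Delta a n * of_real (if k \<le> n then pi / 2 else 0))) {0..pi}"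
      by (intro has_integral_sum has_integral_mult_right has_integral_of_real has_integral_dirichlet_cos) simp
    moreover have "(\<Sum>n<Suc M. Delta a n * of_real (dirichlet n x * cos (real k * x))) = p M x * of_real (cos (real k * x))" for x
      unfolding p_def D_def sum_distrib_right by (intro sum.cong) (auto simp: mult_ac)
    moreover have "(\<Sum>n<Suc M. Delta a n * of_real (if k \<le> n then pi / 2 else 0))
        = of_real (pi / 2) * (\<Sum>n<Suc M. if k \<le> n then Delta a n else 0)"
      unfolding sum_distrib_left by (intro sum.cong) auto
    ultimately have "((\<lambda>x. p M x * of_real (cos (real k * x))) has_integral of_real (pi / 2) * (a k - a (Suc M))) {0..pi}"
      by (simp only: sum_Delta_from[OF that])
    then show ?thesis
      using set_lebesgue_integral_eq_integral(2)[OF pc] by (simp add: integral_unique)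
  qed
  have "a k = of_real (2 / pi) * (LINT x:{0..pi}|lebesgue. f x * of_real (cos (real k * x)))" for k
  proof -
    define c where "c = (LINT x:{0..pi}|lebesgue. f x * of_real (cos (real k * x)))"
    \<comment> \<open>The limit of this sequence is found twice: it is 0 by \<open>L^1\<close>
      convergence, and \<open>c - pi / 2 * a k\<close> because \<open>a\<close> tends to 0.\<close>
    have "(\<lambda>M. c - of_real (pi / 2) * (a k - a (Suc M))) \<longlonglongrightarrow> 0"
    proof (rule Lim_null_comparison)
      show "\<forall>\<^sub>F M in sequentially. norm (c - of_real (pi / 2) * (a k - a (Suc M))) \<le> 14 * pi * a12_norm (t M)"
        using eventually_ge_at_top[of k]
      proof eventually_elim
        case (elim M)
        then have "c - of_real (pi / 2) * (a k - a (Suc M)) = (LINT x:{0..pi}|lebesgue. (f x - p M x) * of_real (cos (real k * x)))"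
          using fc[of k M] pI[of k M] by (simp add: c_def)
        then show ?case using rc(2)[of M k] by simp
      qed
      have "(\<lambda>M. a12_norm (t M)) \<longlonglongrightarrow> 0"
        unfolding t_def using a12_norm_tail_tendsto_0[OF d] by (rule LIMSEQ_Suc)
      from tendsto_mult_right_zero[OF this] show "(\<lambda>M. 14 * pi * a12_norm (t M)) \<longlonglongrightarrow> 0" .
    qed
    moreover have "(\<lambda>M. c - of_real (pi / 2) * (a k - a (Suc M))) \<longlonglongrightarrow> c - of_real (pi / 2) * (a k - 0)"
      by (intro tendsto_intros LIMSEQ_Suc a)
    ultimately have "c - of_real (pi / 2) * (a k - 0) = 0" using LIMSEQ_unique by blast
    then have "c = of_real (pi / 2) * a k" by simp
    then show ?thesis unfolding c_def[symmetric] by (simp add: field_simps)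
  qed
  with fint show ?thesis unfolding is_L1_cosine_series_def by blast
qed

subsection \<open>The sine series\<close>

definition sine_kernel :: "nat \<Rightarrow> real \<Rightarrow> complex" where
  "sine_kernel n x = of_real (conj_dirichlet n x) - of_real (1 / x) * interp (cutoff n) (pi / (2 * x))"

lemma interp_measurable [measurable]: "interp b \<in> borel_measurable borel"
  unfolding interp_def Let_def by measurable

text \<open>The interpolated cutoff vanishes once \<open>pi / (2 * x) \<ge> n + 1\<close>; otherwise
  \<open>1 / x\<close> is itself at most \<open>2 * n\<close>.\<close>

lemma norm_sine_kernel_le:
  assumes n: "n \<ge> 1" and x: "0 < x" "x \<le> pi"
  shows "norm (sine_kernel n x) \<le> 3 * real n"
proof -
  have "norm (of_real (1 / x) * interp (cutoff n) (pi / (2 * x))) \<le> 2 * real n"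
  proof (cases "pi / (2 * x) \<ge> real n + 1")
    case True
    then show ?thesis by (simp add: interp_cutoff_eq_0)
  next
    case False
    then have "1 / x < (real n + 1) * (2 / pi)" using x by (simp add: field_simps)
    also have "\<dots> \<le> (2 * real n) * 1" using n pi_ge_two by (intro mult_mono) auto
    finally have "1 / x \<le> 2 * real n" by simp
    moreover have "norm (interp (cutoff n) (pi / (2 * x))) \<le> 1"
      using x by (intro norm_interp_cutoff_le) simp
    ultimately have "1 / x * norm (interp (cutoff n) (pi / (2 * x))) \<le> (2 * real n) * 1"
      by (intro mult_mono) auto
    then show ?thesis using x by (simp add: norm_mult norm_divide)
  qed
  moreover have "norm (complex_of_real (conj_dirichlet n x)) \<le> real n"
    using norm_conj_dirichlet_le[of n x] by simp
  ultimately show ?thesis unfolding sine_kernel_def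
    using norm_triangle_ineq4[of "complex_of_real (conj_dirichlet n x)" "of_real (1 / x) * interp (cutoff n) (pi / (2 * x))"]
    by linarith
qed

text \<open>The condition \<open>pi / 2 \<le> n * x\<close> says
  \<open>pi / (2 * x) \<le> n\<close>. There the interpolated cutoff no longer depends on
  \<open>n\<close>, so it joins the constant part and cancels the singularity of the
  cotangent.\<close>

lemma admissible_sine_kernel: "admissible_kernel 3 sine_kernel"
  unfolding admissible_kernel_def
proof (intro conjI ballI allI impI)
  show "norm (sine_kernel n x) \<le> 3 * real n" if "n \<ge> 1" "x \<in> {0<..pi}" for n x
    using norm_sine_kernel_le[OF that(1)] that(2) by auto
next
  fix x assume "x \<in> {0<..pi}"
  then have x: "0 < x" "x \<le> pi" by auto
  define g where "g = complex_of_real (cos (x/2) / (2 * sin (x/2)) - min 1 (pi / (2 * x)) / x)"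
  define h where "h = - cis (x/2) / (4 * sin (x/2))"
  define h' where "h' = - cis (-(x/2)) / (4 * sin (x/2))"
  have eq: "sine_kernel n x = g + h * cis (real n * x) + h' * cis (- (real n * x))"
    if "pi / 2 \<le> real n * x" for n
  proof -
    have "pi / (2 * x) \<le> real n" using that x by (simp add: field_simps)
    then have "interp (cutoff n) (pi / (2 * x)) = of_real (min 1 (pi / (2 * x)))"
      using x by (intro interp_cutoff_eq_min) auto
    then show ?thesis
      unfolding sine_kernel_def g_def h_def h'_def conj_dirichlet_cis[OF x] by simp
  qed
  have "norm g \<le> 3"
    unfolding g_def norm_of_real using cot_half_minus_inverse_le[OF x] by linarith
  moreover have "norm (- cis (x/2)) = 1" "norm (- cis (-(x/2))) = 1" by simp_all
  from this[THEN norm_cis_div_sin_half_le[OF x]]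
  have "norm h \<le> 1 / x" "norm h' \<le> 1 / x" by (simp_all add: h_def h'_def)
  moreover have "1 / x \<le> 3 / x" using x by (simp add: divide_right_mono)
  ultimately show "\<exists>g h h'. norm g \<le> 3 \<and> norm h \<le> 3 / x \<and> norm h' \<le> 3 / x \<and>
      (\<forall>n. pi / 2 \<le> real n * x \<longrightarrow> sine_kernel n x =
         g + h * cis (real n * x) + h' * cis (- (real n * x)))"
    using eq by (intro exI[of _ g] exI[of _ h] exI[of _ h']) auto
qed simp

section \<open>Summation by parts and the main term\<close>

lemma sum_by_parts_sine:
  fixes b :: "nat \<Rightarrow> complex"
  shows "(\<Sum>k<N. b (Suc k) * of_real (sin (real (Suc k) * x)))
     = (\<Sum>k<Suc N. Delta b k * of_real (conj_dirichlet k x)) + b (Suc N) * of_real (conj_dirichlet N x)"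
proof (induction N)
  case 0
  then show ?case by (simp add: conj_dirichlet_def)
next
  case (Suc N)
  have "conj_dirichlet (Suc N) x = conj_dirichlet N x + sin (real (Suc N) * x)"
    by (simp add: conj_dirichlet_def)
  then show ?case using Suc by (simp add: Delta_def algebra_simps)
qed

text \<open>For \<open>j \<ge> 1\<close> the differences telescope from \<open>j\<close> on, and
  \<open>b\<close> tends to 0; for \<open>j = 0\<close> both sides vanish.\<close>

lemma Delta_cutoff_sums:
  assumes b: "b \<longlonglongrightarrow> 0" "b 0 = 0"
  shows "(\<lambda>n. Delta b n * cutoff n j) sums b j"
proof (cases "j = 0")
  case True
  then show ?thesis using b by (simp add: cutoff_def)
next
  case False
  have "(\<lambda>N. \<Sum>n<N. Delta b n * cutoff n j) \<longlonglongrightarrow> b j"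
  proof (rule Lim_transform_eventually)
    show "(\<lambda>N. b j - b N) \<longlonglongrightarrow> b j" using tendsto_diff[OF tendsto_const b(1), of "b j"] by simp
    show "\<forall>\<^sub>F N in sequentially. b j - b N = (\<Sum>n<N. Delta b n * cutoff n j)"
      using eventually_ge_at_top[of j]
    proof eventually_elim
      case (elim N)
      have "(\<Sum>n<N. Delta b n * cutoff n j) = (\<Sum>n<N. if j \<le> n then Delta b n else 0)"
        using False by (intro sum.cong) (auto simp: cutoff_def)
      then show ?case using sum_Delta_from[OF elim, of b] by simp
    qed
  qed
  then show ?thesis by (simp add: sums_def)
qed

lemma Delta_interp_cutoff_sums:
  assumes b: "b \<longlonglongrightarrow> 0" "b 0 = 0"
  shows "(\<lambda>n. Delta b n * interp (cutoff n) y) sums interp b y"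
proof -
  define m where "m = nat \<lfloor>y\<rfloor>"
  have lin: "interp c y = c m + of_real (real m - y) * (c m - c (m + 1))" for c
    by (simp add: interp_def Let_def m_def Delta_def)
  have "(\<lambda>n. Delta b n * cutoff n m + of_real (real m - y) * (Delta b n * cutoff n m - Delta b n * cutoff n (m + 1)))
     sums (b m + of_real (real m - y) * (b m - b (m + 1)))"
    by (intro sums_add sums_mult sums_diff Delta_cutoff_sums b)
  then show ?thesis unfolding lin by (simp add: algebra_simps)
qed

text \<open>The remainder is the series of sine kernels with coefficients \<open>Delta b n\<close>;
  the constant is \<open>7 * pi\<close> times the kernel constant 3.\<close>

theorem sine_series_asymptotics:
  assumes b: "b \<longlonglongrightarrow> 0" "b 0 = 0" and in_b: "in_a12 (Delta b)"
  shows "\<exists>\<Gamma> :: real \<Rightarrow> complex.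
           (\<forall>x\<in>{0<..pi}.
              (\<lambda>n. b (Suc n) * of_real (sin (real (Suc n) * x))) sums
                (of_real (1 / x) * interp b (pi / (2 * x)) + \<Gamma> x)) \<and>
           set_integrable lebesgue {0..pi} \<Gamma> \<and>
           (LINT x:{0..pi}|lebesgue. norm (\<Gamma> x)) \<le> 21 * pi * a12_norm (Delta b)"
proof -
  \<comment> \<open>Clearing the entry at 0 changes neither the norm nor the series, because
    \<open>sine_kernel 0\<close> is zero.\<close>
  define d where "d = tail_from 1 (Delta b)"
  have d: "in_a12 d" "d 0 = 0" using in_a12_tail_from[OF in_b] by (simp_all add: d_def tail_from_def)
  have dn: "a12_norm d = a12_norm (Delta b)" by (rule a12_norm_cong) (simp add: d_def tail_from_def)
  define \<Gamma> where "\<Gamma> x = (\<Sum>n. d n * sine_kernel n x)" for x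
  have "cutoff 0 = (\<lambda>_. 0)" by (simp add: cutoff_def fun_eq_iff)
  then have K0: "sine_kernel 0 x = 0" for x
    by (simp add: sine_kernel_def conj_dirichlet_def interp_def Delta_def)
  have [measurable]: "sine_kernel n \<in> borel_measurable borel" for n
    unfolding sine_kernel_def by measurable
  have meas: "\<Gamma> \<in> borel_measurable borel" unfolding \<Gamma>_def by measurable
  have le: "(\<integral>\<^sup>+x\<in>{0<..pi}. ennreal (norm (\<Gamma> x)) \<partial>lborel) \<le> ennreal (21 * pi * a12_norm (Delta b))"
    unfolding \<Gamma>_def dn[symmetric]
    using nn_integral_admissible_kernel_series_le[OF admissible_sine_kernel d] by simp
  have B: "0 \<le> 21 * pi * a12_norm (Delta b)" using a12_norm_nonneg[OF in_b] by simp
  have "(\<lambda>n. b (Suc n) * of_real (sin (real (Suc n) * x))) sums (of_real (1 / x) * interp b (pi / (2 * x)) + \<Gamma> x)"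
    if x: "0 < x" "x \<le> pi" for x
  proof -
    let ?c = "\<lambda>n. complex_of_real (conj_dirichlet n x)"
    have "(\<lambda>n. d n * sine_kernel n x) sums \<Gamma> x"
      unfolding \<Gamma>_def by (intro summable_sums summable_norm_cancel[OF admissible_kernel_series_summable[OF admissible_sine_kernel d x]])
    moreover have "d n * sine_kernel n x = Delta b n * sine_kernel n x" for n
      by (cases "n = 0") (auto simp: K0 d_def tail_from_def)
    ultimately have "(\<lambda>n. Delta b n * sine_kernel n x) sums \<Gamma> x" by simp
    \<comment> \<open>Adding the expansion of the main term cancels the interpolated cutoffs and
      leaves the conjugate Dirichlet kernels.\<close>
    from sums_add[OF sums_mult[OF Delta_interp_cutoff_sums[OF b, of "pi / (2 * x)"], of "of_real (1 / x)"] this]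
    have "(\<lambda>n. Delta b n * ?c n) sums (of_real (1 / x) * interp b (pi / (2 * x)) + \<Gamma> x)"
      by (simp add: sine_kernel_def algebra_simps)
    then have 1: "(\<lambda>N. \<Sum>k<Suc N. Delta b k * ?c k) \<longlonglongrightarrow> of_real (1 / x) * interp b (pi / (2 * x)) + \<Gamma> x"
      unfolding sums_def by (rule LIMSEQ_Suc)
    \<comment> \<open>The boundary term of the summation by parts vanishes, since for fixed
      \<open>x\<close> the kernels are bounded in \<open>N\<close> by
      \<open>1 / sin (x / 2)\<close>.\<close>
    have 2: "(\<lambda>N. b (Suc N) * ?c N) \<longlonglongrightarrow> 0"
    proof (rule Lim_null_comparison[OF always_eventually])
      have s: "sin (x/2) > 0" by (rule sin_half_pos[OF x])
      have "\<bar>conj_dirichlet N x\<bar> \<le> 1 / sin (x/2)" for N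
      proof -
        have "\<bar>2 * sin (x/2) * conj_dirichlet N x\<bar> \<le> 2"
          unfolding conj_dirichlet_closed
          using cos_le_one[of "x/2"] cos_ge_minus_one[of "x/2"] cos_le_one[of "real N * x + x/2"] cos_ge_minus_one[of "real N * x + x/2"]
          by linarith
        then show ?thesis using s by (simp add: abs_mult field_simps)
      qed
      then show "\<forall>N. norm (b (Suc N) * ?c N) \<le> norm (b (Suc N)) * (1 / sin (x/2))"
        by (auto simp only: norm_mult norm_of_real intro!: mult_left_mono norm_ge_zero)
      show "(\<lambda>N. norm (b (Suc N)) * (1 / sin (x/2))) \<longlonglongrightarrow> 0"
        by (intro tendsto_mult_left_zero tendsto_norm_zero LIMSEQ_Suc b)
    qed
    have "(\<lambda>N. (\<Sum>k<Suc N. Delta b k * ?c k) + b (Suc N) * ?c N) \<longlonglongrightarrow> of_real (1 / x) * interp b (pi / (2 * x)) + \<Gamma> x"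
      using tendsto_add[OF 1 2] by simp
    then show ?thesis unfolding sums_def sum_by_parts_sine .
  qed
  with set_integrable_from_nn_integral_bound[OF meas le]
    integral_norm_from_nn_integral_bound[OF meas B le] show ?thesis
    by (intro exI[of _ \<Gamma>]) auto
qed

theorem theorem4:
  "\<exists>C::real. C > 0 \<and>
     (\<forall>(a :: nat \<Rightarrow> complex) (b :: nat \<Rightarrow> complex).
        a \<longlonglongrightarrow> 0 \<longrightarrow> b \<longlonglongrightarrow> 0 \<longrightarrow> b 0 = 0 \<longrightarrow>
        in_a12 (Delta a) \<longrightarrow> in_a12 (Delta b) \<longrightarrow>
        is_L1_cosine_series a \<and>
        (\<exists>\<Gamma> :: real \<Rightarrow> complex.
           (\<forall>x\<in>{0<..pi}.
              (\<lambda>n. b (Suc n) * of_real (sin (real (Suc n) * x))) sums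
                (of_real (1 / x) * interp b (pi / (2 * x)) + \<Gamma> x)) \<and>
           set_integrable lebesgue {0..pi} \<Gamma> \<and>
           (LINT x:{0..pi}|lebesgue. norm (\<Gamma> x)) \<le> C * a12_norm (Delta b)))"
proof (intro exI[of _ "21 * pi"] conjI allI impI)
  show "0 < 21 * pi" by simp
qed (blast intro: cosine_series_L1 sine_series_asymptotics)+

end
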